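(* Let $\Phi,\Psi\in{\bf PFm}$ be modal formulas of ${\rm FP}(Ł,Ł)$ whose event formulas together use exactly $n$ propositional variables. Then $\Phi\vdash_{FP}\Psi$ if and only if for every state $s$ of ${\rm Free}(n)$, $s\models\Phi$ implies $s\models\Psi$.
   Context: Łukasiewicz logic Ł: formulas are built from propositional variables using $\oplus,\neg,\bot$, with abbreviations $\top=\neg\bot$, $\varphi\to\psi=\neg\varphi\oplus\psi$, $\varphi\odot\psi=\neg(\neg\varphi\oplus\neg\psi)$, $\varphi\vee\psi=(\varphi\to\psi)\to\psi$, $\varphi\wedge\psi=\neg(\neg\varphi\vee\neg\psi)$, $\varphi\leftrightarrow\psi=(\varphi\to\psi)\wedge(\psi\to\varphi)$; axioms $\varphi\to(\psi\to\varphi)$, $(\varphi\to\psi)\to((\psi\to\gamma)\to(\varphi\to\gamma))$, $((\varphi\to\psi)\to\psi)\to((\psi\to\varphi)\to\varphi)$, $(\neg\varphi\to\neg\psi)\to(\psi\to\varphi)$, modus ponens. $[0,1]_{MV}=([0,1],\oplus,\neg,0)$, $x\oplus y=\min(1,x+y)$, $\neg x=1-x$. ${\rm Free}(n)$ is the free MV-algebra on $n$ generators, identified with the algebra of McNaughton functions $[0,1]^n\to[0,1]$; $f_\varphi$ is the McNaughton function of a formula $\varphi$ in $n$ variables. ${\rm FP}(Ł,Ł)$: event formulas are Łukasiewicz formulas; modal formulas (set ${\bf PFm}$) are built from atomic modal formulas $P(\varphi)$ and $\top,\bot$ by Łukasiewicz connectives, each of the form $t[P(\varphi_1),\dots,P(\varphi_k)]$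 for a Łukasiewicz term $t$. Axioms and rules: Ł for events; Ł for modal formulas; (P1) $\neg P(\varphi)\leftrightarrow P(\neg\varphi)$; (P2) $P(\varphi\to\psi)\to(P(\varphi)\to P(\psi))$; (P3) $P(\varphi\oplus\psi)\leftrightarrow[(P(\varphi)\to P(\varphi\odot\psi))\to P(\psi)]$; (N) from $\varphi$ derive $P(\varphi)$. A state of an MV-algebra $\mathbf{A}$ is a map $s:A\to[0,1]$ with $s(\top)=1$ and $s(a\oplus b)=s(a)+s(b)$ whenever $a\odot b=\bot$. For $\Phi=t[P(\varphi_1),\dots,P(\varphi_k)]$ and a state $s$ of ${\rm Free}(n)$, $s\models\Phi$ means $t^{[0,1]_{MV}}[s(f_{\varphi_1}),\dots,s(f_{\varphi_k})]=1$.
   Formalization: With ⊕, ¬, ⊥ primitive, the four listed axioms do not derive ⊤ = ¬⊥ (⊥ := 1/2 validates them), so completeness fails for Ψ = ⊤; the axioms ⊥→φ, (φ⊕ψ)→(¬φ→ψ) and (¬φ→ψ)→(φ⊕ψ) are added for both event and modal formulas. *)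

theory Defs
  imports "HOL-Analysis.Analysis"
begin

section \<open>Formulas of \L{}ukasiewicz logic\<close>

datatype (atoms: 'a) form =
    Atom 'a
  | Bot  (\<open>\<^bold>\<bottom>\<close>)
  | Neg "'a form"  (\<open>\<^bold>\<not> _\<close> [90] 90)
  | Plus "'a form" "'a form"  (infixl \<open>\<^bold>\<oplus>\<close> 75)

definition Top :: "'a form"  (\<open>\<^bold>\<top>\<close>)
  where "\<^bold>\<top> = \<^bold>\<not> \<^bold>\<bottom>"

definition Imp :: "'a form \<Rightarrow> 'a form \<Rightarrow> 'a form"  (infixr \<open>\<^bold>\<rightarrow>\<close> 60)
  where "\<phi> \<^bold>\<rightarrow> \<psi> = \<^bold>\<not> \<phi> \<^bold>\<oplus> \<psi>"

definition Times :: "'a form \<Rightarrow> 'a form \<Rightarrow> 'a form"  (infixl \<open>\<^bold>\<odot>\<close> 80)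
  where "\<phi> \<^bold>\<odot> \<psi> = \<^bold>\<not> (\<^bold>\<not> \<phi> \<^bold>\<oplus> \<^bold>\<not> \<psi>)"

definition Or :: "'a form \<Rightarrow> 'a form \<Rightarrow> 'a form"  (infixl \<open>\<^bold>\<or>\<close> 65)
  where "\<phi> \<^bold>\<or> \<psi> = ((\<phi> \<^bold>\<rightarrow> \<psi>) \<^bold>\<rightarrow> \<psi>)"

definition And :: "'a form \<Rightarrow> 'a form \<Rightarrow> 'a form"  (infixl \<open>\<^bold>\<and>\<close> 70)
  where "\<phi> \<^bold>\<and> \<psi> = \<^bold>\<not> (\<^bold>\<not> \<phi> \<^bold>\<or> \<^bold>\<not> \<psi>)"

definition Iff :: "'a form \<Rightarrow> 'a form \<Rightarrow> 'a form"  (infix \<open>\<^bold>\<leftrightarrow>\<close> 55)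
  where "\<phi> \<^bold>\<leftrightarrow> \<psi> = ((\<phi> \<^bold>\<rightarrow> \<psi>) \<^bold>\<and> (\<psi> \<^bold>\<rightarrow> \<phi>))"

text \<open>
  The four familiar axioms are those of the calculus with primitives \<open>\<rightarrow>\<close> and \<open>\<not>\<close>.
  Here \<open>\<phi> \<rightarrow> \<psi>\<close> abbreviates \<open>\<not>\<phi> \<oplus> \<psi>\<close>, so these schemes alone say nothing about \<open>\<bottom>\<close> or about
  \<open>\<phi> \<oplus> \<psi>\<close> with \<open>\<phi>\<close> not a negation: they would derive neither \<open>\<top>\<close> nor \<open>p \<oplus> \<not>p\<close>.  The
  schemes \<open>Bot\<close>, \<open>Plus1\<close> and \<open>Plus2\<close> say that \<open>\<bottom>\<close> is falsum and that
  \<open>\<phi> \<oplus> \<psi>\<close> is \<open>\<not>\<phi> \<rightarrow> \<psi>\<close>.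
\<close>

inductive luk_axiom :: "'a form \<Rightarrow> bool" where
  A1: "luk_axiom (\<phi> \<^bold>\<rightarrow> (\<psi> \<^bold>\<rightarrow> \<phi>))"
| A2: "luk_axiom ((\<phi> \<^bold>\<rightarrow> \<psi>) \<^bold>\<rightarrow> ((\<psi> \<^bold>\<rightarrow> \<gamma>) \<^bold>\<rightarrow> (\<phi> \<^bold>\<rightarrow> \<gamma>)))"
| A3: "luk_axiom (((\<phi> \<^bold>\<rightarrow> \<psi>) \<^bold>\<rightarrow> \<psi>) \<^bold>\<rightarrow> ((\<psi> \<^bold>\<rightarrow> \<phi>) \<^bold>\<rightarrow> \<phi>))"
| A4: "luk_axiom ((\<^bold>\<not> \<phi> \<^bold>\<rightarrow> \<^bold>\<not> \<psi>) \<^bold>\<rightarrow> (\<psi> \<^bold>\<rightarrow> \<phi>))"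
| Bot: "luk_axiom (\<^bold>\<bottom> \<^bold>\<rightarrow> \<phi>)"
| Plus1: "luk_axiom ((\<phi> \<^bold>\<oplus> \<psi>) \<^bold>\<rightarrow> (\<^bold>\<not> \<phi> \<^bold>\<rightarrow> \<psi>))"
| Plus2: "luk_axiom ((\<^bold>\<not> \<phi> \<^bold>\<rightarrow> \<psi>) \<^bold>\<rightarrow> (\<phi> \<^bold>\<oplus> \<psi>))"

inductive luk_thm :: "'a form \<Rightarrow> bool"  (\<open>\<turnstile>\<^sub>L _\<close> [50] 50) where
  ax: "luk_axiom \<phi> \<Longrightarrow> \<turnstile>\<^sub>L \<phi>"
| mp: "\<turnstile>\<^sub>L \<phi> \<Longrightarrow> \<turnstile>\<^sub>L \<phi> \<^bold>\<rightarrow> \<psi> \<Longrightarrow> \<turnstile>\<^sub>L \<psi>"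


section \<open>The logic FP(\L{},\L{})\<close>

text \<open>
  A modal formula \<open>t[P(\<phi>\<^sub>1), \<dots>, P(\<phi>\<^sub>k)]\<close> is a formula whose atoms are event formulas;
  \<open>P(\<phi>)\<close> is the atom \<open>\<phi>\<close>.
\<close>

type_synonym event = "nat form"
type_synonym modal = "event form"

abbreviation P :: "event \<Rightarrow> modal"
  where "P \<equiv> Atom"

definition event_vars :: "modal \<Rightarrow> nat set"
  where "event_vars \<Phi> = (\<Union>\<phi> \<in> atoms \<Phi>. atoms \<phi>)"

text \<open>
  Premises are modal, so an event formula occurring in a derivation is a theorem of
  \L{}ukasiewicz logic; this is the premise of the necessitation rule \<open>N\<close>.
\<close>

inductive FP_deriv :: "modal set \<Rightarrow> modal \<Rightarrow> bool"  (infix \<open>\<turnstile>\<^sub>F\<^sub>P\<close> 50)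
  for \<Gamma> :: "modal set" where
  hyp: "\<Phi> \<in> \<Gamma> \<Longrightarrow> \<Gamma> \<turnstile>\<^sub>F\<^sub>P \<Phi>"
| ax: "luk_axiom \<Phi> \<Longrightarrow> \<Gamma> \<turnstile>\<^sub>F\<^sub>P \<Phi>"
| P1: "\<Gamma> \<turnstile>\<^sub>F\<^sub>P \<^bold>\<not> P \<phi> \<^bold>\<leftrightarrow> P (\<^bold>\<not> \<phi>)"
| P2: "\<Gamma> \<turnstile>\<^sub>F\<^sub>P P (\<phi> \<^bold>\<rightarrow> \<psi>) \<^bold>\<rightarrow> (P \<phi> \<^bold>\<rightarrow> P \<psi>)"
| P3: "\<Gamma> \<turnstile>\<^sub>F\<^sub>P P (\<phi> \<^bold>\<oplus> \<psi>) \<^bold>\<leftrightarrow> ((P \<phi> \<^bold>\<rightarrow> P (\<phi> \<^bold>\<odot> \<psi>)) \<^bold>\<rightarrow> P \<psi>)"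
| mp: "\<Gamma> \<turnstile>\<^sub>F\<^sub>P \<Phi> \<Longrightarrow> \<Gamma> \<turnstile>\<^sub>F\<^sub>P \<Phi> \<^bold>\<rightarrow> \<Psi> \<Longrightarrow> \<Gamma> \<turnstile>\<^sub>F\<^sub>P \<Psi>"
| N: "\<turnstile>\<^sub>L \<phi> \<Longrightarrow> \<Gamma> \<turnstile>\<^sub>F\<^sub>P P \<phi>"


section \<open>MV-algebras and states\<close>

record 'a mv =
  mv_carrier :: "'a set"
  mv_plus :: "'a \<Rightarrow> 'a \<Rightarrow> 'a"
  mv_neg :: "'a \<Rightarrow> 'a"
  mv_zero :: 'a

locale mv_algebra =
  fixes A :: "('a, 'b) mv_scheme"
  assumes zero_closed: "mv_zero A \<in> mv_carrier A"
    and neg_closed: "x \<in> mv_carrier A \<Longrightarrow> mv_neg A x \<in> mv_carrier A"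
    and plus_closed: "x \<in> mv_carrier A \<Longrightarrow> y \<in> mv_carrier A \<Longrightarrow> mv_plus A x y \<in> mv_carrier A"
    and plus_assoc: "x \<in> mv_carrier A \<Longrightarrow> y \<in> mv_carrier A \<Longrightarrow> z \<in> mv_carrier A \<Longrightarrow>
      mv_plus A (mv_plus A x y) z = mv_plus A x (mv_plus A y z)"
    and plus_comm: "x \<in> mv_carrier A \<Longrightarrow> y \<in> mv_carrier A \<Longrightarrow> mv_plus A x y = mv_plus A y x"
    and plus_zero: "x \<in> mv_carrier A \<Longrightarrow> mv_plus A x (mv_zero A) = x"
    and neg_neg: "x \<in> mv_carrier A \<Longrightarrow> mv_neg A (mv_neg A x) = x"
    and plus_one: "x \<in> mv_carrier A \<Longrightarrow> mv_plus A x (mv_neg A (mv_zero A)) = mv_neg A (mv_zero A)"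
    and luk: "x \<in> mv_carrier A \<Longrightarrow> y \<in> mv_carrier A \<Longrightarrow>
      mv_plus A (mv_neg A (mv_plus A (mv_neg A x) y)) y
        = mv_plus A (mv_neg A (mv_plus A (mv_neg A y) x)) x"

definition mv_one :: "('a, 'b) mv_scheme \<Rightarrow> 'a"
  where "mv_one A = mv_neg A (mv_zero A)"

definition mv_times :: "('a, 'b) mv_scheme \<Rightarrow> 'a \<Rightarrow> 'a \<Rightarrow> 'a"
  where "mv_times A x y = mv_neg A (mv_plus A (mv_neg A x) (mv_neg A y))"

primrec mv_eval :: "('b, 'c) mv_scheme \<Rightarrow> ('a \<Rightarrow> 'b) \<Rightarrow> 'a form \<Rightarrow> 'b" where
  "mv_eval A v (Atom p) = v p"
| "mv_eval A v \<^bold>\<bottom> = mv_zero A"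
| "mv_eval A v (\<^bold>\<not> \<phi>) = mv_neg A (mv_eval A v \<phi>)"
| "mv_eval A v (\<phi> \<^bold>\<oplus> \<psi>) = mv_plus A (mv_eval A v \<phi>) (mv_eval A v \<psi>)"

text \<open>Only the values of \<open>s\<close> on the carrier matter.\<close>

definition is_state :: "('a, 'b) mv_scheme \<Rightarrow> ('a \<Rightarrow> real) \<Rightarrow> bool" where
  "is_state A s \<longleftrightarrow>
     s \<in> mv_carrier A \<rightarrow> {0..1} \<and>
     s (mv_one A) = 1 \<and>
     (\<forall>a \<in> mv_carrier A. \<forall>b \<in> mv_carrier A.
        mv_times A a b = mv_zero A \<longrightarrow> s (mv_plus A a b) = s a + s b)"

definition unit_MV :: "real mv" where
  "unit_MV = \<lparr>mv_carrier = {0..1}, mv_plus = (\<lambda>x y. min 1 (x + y)), mv_neg = (\<lambda>x. 1 - x),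
              mv_zero = 0\<rparr>"


section \<open>McNaughton functions and the free MV-algebra\<close>

text \<open>
  A point of \<open>[0,1]\<^sup>n\<close> is a function on \<open>nat\<close> that is \<open>undefined\<close> from \<open>n\<close> on.  On this set the
  product topology of \<open>nat \<Rightarrow> real\<close>, used by \<open>continuous_on\<close> below, is the Euclidean one.
\<close>

definition cube :: "nat \<Rightarrow> (nat \<Rightarrow> real) set"
  where "cube n = {..<n} \<rightarrow>\<^sub>E {0..1}"

definition mcnaughton :: "nat \<Rightarrow> ((nat \<Rightarrow> real) \<Rightarrow> real) \<Rightarrow> bool" where
  "mcnaughton n f \<longleftrightarrow>
     f \<in> cube n \<rightarrow>\<^sub>E {0..1} \<and>
     continuous_on (cube n) f \<and>
     (\<exists>k (a :: nat \<Rightarrow> nat \<Rightarrow> int) (b :: nat \<Rightarrow> int). \<forall>x \<in> cube n. \<exists>i<k.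
        f x = (\<Sum>j<n. real_of_int (a i j) * x j) + real_of_int (b i))"

definition Free_MV :: "nat \<Rightarrow> ((nat \<Rightarrow> real) \<Rightarrow> real) mv" where
  "Free_MV n =
     \<lparr>mv_carrier = {f. mcnaughton n f},
      mv_plus = (\<lambda>f g. \<lambda>x \<in> cube n. mv_plus unit_MV (f x) (g x)),
      mv_neg = (\<lambda>f. \<lambda>x \<in> cube n. mv_neg unit_MV (f x)),
      mv_zero = (\<lambda>x \<in> cube n. mv_zero unit_MV)\<rparr>"

text \<open>
  The McNaughton function \<open>f\<^sub>\<phi>\<close>, where \<open>e\<close> numbers the propositional variables:
  the variable \<open>p\<close> is read as the coordinate \<open>e p\<close>.
\<close>

definition mcn_fun :: "nat \<Rightarrow> (nat \<Rightarrow> nat) \<Rightarrow> event \<Rightarrow> (nat \<Rightarrow> real) \<Rightarrow> real"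
  where "mcn_fun n e \<phi> = (\<lambda>x \<in> cube n. mv_eval unit_MV (\<lambda>p. x (e p)) \<phi>)"

definition state_sat ::
    "nat \<Rightarrow> (nat \<Rightarrow> nat) \<Rightarrow> (((nat \<Rightarrow> real) \<Rightarrow> real) \<Rightarrow> real) \<Rightarrow> modal \<Rightarrow> bool"
  where "state_sat n e s \<Phi> \<longleftrightarrow> mv_eval unit_MV (\<lambda>\<phi>. s (mcn_fun n e \<phi>)) \<Phi> = 1"


section \<open>The algebras above are MV-algebras\<close>

lemma mv_algebra_unit_MV: "mv_algebra unit_MV"
  by unfold_locales (auto simp: unit_MV_def min_def)

lemma mcnaughton_zero: "mcnaughton n (\<lambda>x \<in> cube n. 0)"
  unfolding mcnaughton_def
proof (intro conjI)
  show "continuous_on (cube n) (\<lambda>x \<in> cube n. 0 :: real)"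
    by (simp cong: continuous_on_cong)
  show "\<exists>k (a :: nat \<Rightarrow> nat \<Rightarrow> int) (b :: nat \<Rightarrow> int). \<forall>x \<in> cube n. \<exists>i<k.
      (\<lambda>x \<in> cube n. 0) x = (\<Sum>j<n. real_of_int (a i j) * x j) + real_of_int (b i)"
    by (rule exI[of _ 1], rule exI[of _ "\<lambda>_ _. 0"], rule exI[of _ "\<lambda>_. 0"]) auto
qed auto

lemma mcnaughton_proj:
  assumes "i < n"
  shows "mcnaughton n (\<lambda>x \<in> cube n. x i)"
  unfolding mcnaughton_def
proof (intro conjI)
  show "(\<lambda>x \<in> cube n. x i) \<in> cube n \<rightarrow>\<^sub>E {0..1}"
    using assms by (auto simp: cube_def)
  have "continuous_on (cube n) (\<lambda>x. x i :: real)"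
    by (rule continuous_on_coordinatewise_then_product[of _ "\<lambda>x. x", THEN continuous_on_product_then_coordinatewise])
       (rule continuous_on_subset[OF continuous_on_product_coordinates], simp)
  then show "continuous_on (cube n) (\<lambda>x \<in> cube n. x i :: real)"
    by (simp cong: continuous_on_cong)
  have "x i = (\<Sum>j<n. real_of_int (if j = i then 1 else 0) * x j)" for x :: "nat \<Rightarrow> real"
    using assms by (simp add: if_distrib if_distribR sum.delta cong: if_cong)
  then show "\<exists>k (a :: nat \<Rightarrow> nat \<Rightarrow> int) (b :: nat \<Rightarrow> int). \<forall>x \<in> cube n. \<exists>i'<k.
      (\<lambda>x \<in> cube n. x i) x = (\<Sum>j<n. real_of_int (a i' j) * x j) + real_of_int (b i')"
    by (intro exI[of _ 1] exI[of _ "\<lambda>_ j. if j = i then 1 else 0"] exI[of _ "\<lambda>_. 0"]) auto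
qed

lemma mcnaughton_neg:
  assumes "mcnaughton n f"
  shows "mcnaughton n (\<lambda>x \<in> cube n. 1 - f x)"
  unfolding mcnaughton_def
proof (intro conjI)
  show "(\<lambda>x \<in> cube n. 1 - f x) \<in> cube n \<rightarrow>\<^sub>E {0..1}"
    using assms by (fastforce simp: mcnaughton_def PiE_iff)
  have "continuous_on (cube n) (\<lambda>x. 1 - f x)"
    using assms by (auto simp: mcnaughton_def intro!: continuous_intros)
  then show "continuous_on (cube n) (\<lambda>x \<in> cube n. 1 - f x)"
    by (simp cong: continuous_on_cong)
  obtain k and a :: "nat \<Rightarrow> nat \<Rightarrow> int" and b :: "nat \<Rightarrow> int"
    where *: "\<forall>x \<in> cube n. \<exists>i<k. f x = (\<Sum>j<n. real_of_int (a i j) * x j) + real_of_int (b i)"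
    using assms unfolding mcnaughton_def by blast
  show "\<exists>k (a :: nat \<Rightarrow> nat \<Rightarrow> int) (b :: nat \<Rightarrow> int). \<forall>x \<in> cube n. \<exists>i<k.
      (\<lambda>x \<in> cube n. 1 - f x) x = (\<Sum>j<n. real_of_int (a i j) * x j) + real_of_int (b i)"
    using * by (intro exI[of _ k] exI[of _ "\<lambda>i j. - a i j"] exI[of _ "\<lambda>i. 1 - b i"])
      (fastforce simp: sum_negf)
qed

lemma mcnaughton_plus:
  assumes "mcnaughton n f" "mcnaughton n g"
  shows "mcnaughton n (\<lambda>x \<in> cube n. min 1 (f x + g x))"
  unfolding mcnaughton_def
proof (intro conjI)
  show "(\<lambda>x \<in> cube n. min 1 (f x + g x)) \<in> cube n \<rightarrow>\<^sub>E {0..1}"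
    using assms by (fastforce simp: mcnaughton_def PiE_iff)
  have "continuous_on (cube n) (\<lambda>x. min 1 (f x + g x))"
    using assms by (auto simp: mcnaughton_def intro!: continuous_intros)
  then show "continuous_on (cube n) (\<lambda>x \<in> cube n. min 1 (f x + g x))"
    by (simp cong: continuous_on_cong)
  obtain k and a :: "nat \<Rightarrow> nat \<Rightarrow> int" and b :: "nat \<Rightarrow> int"
    where f: "\<forall>x \<in> cube n. \<exists>i<k. f x = (\<Sum>j<n. real_of_int (a i j) * x j) + real_of_int (b i)"
    using assms unfolding mcnaughton_def by blast
  obtain l and c :: "nat \<Rightarrow> nat \<Rightarrow> int" and d :: "nat \<Rightarrow> int"
    where g: "\<forall>x \<in> cube n. \<exists>i<l. g x = (\<Sum>j<n. real_of_int (c i j) * x j) + real_of_int (d i)"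
    using assms unfolding mcnaughton_def by blast
  define A where "A = (\<lambda>i j. if i = k * l then 0 else a (i div l) j + c (i mod l) j)"
  define B where "B = (\<lambda>i. if i = k * l then 1 else b (i div l) + d (i mod l))"
  have "\<exists>i < Suc (k * l). min 1 (f x + g x) = (\<Sum>j<n. real_of_int (A i j) * x j) + real_of_int (B i)"
    if x: "x \<in> cube n" for x
  proof (cases "f x + g x \<ge> 1")
    case True
    then show ?thesis by (intro exI[of _ "k * l"]) (simp add: A_def B_def)
  next
    case False
    obtain i where i: "i < k" "f x = (\<Sum>j<n. real_of_int (a i j) * x j) + real_of_int (b i)"
      using f x by blast
    obtain j where j: "j < l" "g x = (\<Sum>m<n. real_of_int (c j m) * x m) + real_of_int (d j)"
      using g x by blast
    have "i * l + j < Suc i * l" using j by simp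
    also have "\<dots> \<le> k * l" using i by (intro mult_right_mono) auto
    finally have "i * l + j < k * l" .
    moreover have "(i * l + j) div l = i" "(i * l + j) mod l = j" using j by auto
    ultimately show ?thesis
      using False i j
      by (intro exI[of _ "i * l + j"]) (simp add: A_def B_def sum.distrib algebra_simps)
  qed
  then show "\<exists>k (a :: nat \<Rightarrow> nat \<Rightarrow> int) (b :: nat \<Rightarrow> int). \<forall>x \<in> cube n. \<exists>i<k.
      (\<lambda>x \<in> cube n. min 1 (f x + g x)) x
        = (\<Sum>j<n. real_of_int (a i j) * x j) + real_of_int (b i)"
    by (intro exI[of _ "Suc (k * l)"] exI[of _ A] exI[of _ B]) simp
qed

lemma mv_algebra_Free_MV: "mv_algebra (Free_MV n)"
proof
  interpret U: mv_algebra unit_MV by (rule mv_algebra_unit_MV)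
  have ran: "f x \<in> mv_carrier unit_MV" if "f \<in> mv_carrier (Free_MV n)" "x \<in> cube n" for f x
    using that by (auto simp: Free_MV_def mcnaughton_def unit_MV_def PiE_iff)
  have ext: "f = (\<lambda>x \<in> cube n. f x)" if "f \<in> mv_carrier (Free_MV n)" for f
    using that by (auto simp: Free_MV_def mcnaughton_def PiE_iff extensional_restrict)
  fix f g h
  show "mv_zero (Free_MV n) \<in> mv_carrier (Free_MV n)"
    using mcnaughton_zero by (simp add: Free_MV_def unit_MV_def)
  assume f: "f \<in> mv_carrier (Free_MV n)"
  note rf = ran[OF f]
  show "mv_neg (Free_MV n) f \<in> mv_carrier (Free_MV n)"
    using f mcnaughton_neg by (simp add: Free_MV_def unit_MV_def)
  show "mv_plus (Free_MV n) f (mv_zero (Free_MV n)) = f"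
    by (subst (2) ext[OF f]) (auto simp: Free_MV_def U.plus_zero rf)
  show "mv_neg (Free_MV n) (mv_neg (Free_MV n) f) = f"
    by (subst (2) ext[OF f]) (auto simp: Free_MV_def U.neg_neg rf)
  show "mv_plus (Free_MV n) f (mv_neg (Free_MV n) (mv_zero (Free_MV n)))
      = mv_neg (Free_MV n) (mv_zero (Free_MV n))"
    by (auto simp: Free_MV_def U.plus_one rf)
  assume g: "g \<in> mv_carrier (Free_MV n)"
  note rg = ran[OF g]
  show "mv_plus (Free_MV n) f g \<in> mv_carrier (Free_MV n)"
    using f g mcnaughton_plus by (simp add: Free_MV_def unit_MV_def)
  show "mv_plus (Free_MV n) f g = mv_plus (Free_MV n) g f"
    by (auto simp: Free_MV_def U.plus_comm rf rg)
  show "mv_plus (Free_MV n) (mv_neg (Free_MV n) (mv_plus (Free_MV n) (mv_neg (Free_MV n) f) g)) g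
      = mv_plus (Free_MV n) (mv_neg (Free_MV n) (mv_plus (Free_MV n) (mv_neg (Free_MV n) g) f)) f"
    by (auto simp: Free_MV_def U.luk rf rg)
  assume h: "h \<in> mv_carrier (Free_MV n)"
  show "mv_plus (Free_MV n) (mv_plus (Free_MV n) f g) h
      = mv_plus (Free_MV n) f (mv_plus (Free_MV n) g h)"
    by (auto simp: Free_MV_def U.plus_assoc rf rg ran[OF h])
qed

lemma mcnaughton_mcn_fun:
  assumes "e ` atoms \<phi> \<subseteq> {..<n}"
  shows "mcnaughton n (mcn_fun n e \<phi>)"
  using assms
proof (induction \<phi>)
  case (Atom p)
  have "mcn_fun n e (Atom p) = (\<lambda>x \<in> cube n. x (e p))"
    by (auto simp: mcn_fun_def fun_eq_iff)
  with Atom have "mcnaughton n (mcn_fun n e (Atom p))" using mcnaughton_proj by simp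
  then show ?case .
next
  case Bot
  have "mcn_fun n e \<^bold>\<bottom> = (\<lambda>x \<in> cube n. 0)"
    by (auto simp: mcn_fun_def unit_MV_def fun_eq_iff)
  then have "mcnaughton n (mcn_fun n e \<^bold>\<bottom>)" using mcnaughton_zero by simp
  then show ?case .
next
  case (Neg \<phi>)
  have "mcn_fun n e (\<^bold>\<not> \<phi>) = (\<lambda>x \<in> cube n. 1 - mcn_fun n e \<phi> x)"
    by (auto simp: mcn_fun_def unit_MV_def fun_eq_iff)
  with Neg have "mcnaughton n (mcn_fun n e (\<^bold>\<not> \<phi>))" using mcnaughton_neg by simp
  then show ?case .
next
  case (Plus \<phi> \<psi>)
  have "mcn_fun n e (\<phi> \<^bold>\<oplus> \<psi>) = (\<lambda>x \<in> cube n. min 1 (mcn_fun n e \<phi> x + mcn_fun n e \<psi> x))"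
    by (auto simp: mcn_fun_def unit_MV_def fun_eq_iff)
  with Plus have "mcnaughton n (mcn_fun n e (\<phi> \<^bold>\<oplus> \<psi>))" using mcnaughton_plus by (simp add: image_Un)
  then show ?case .
qed

end

(*
Proof idea.  For completeness, let C be the set of points (s(f_1), ..., s(f_k)) for states s.  It is
the convex hull of the image of the cube under (f_1, ..., f_k), and since the f_i are piecewise
linear, Fourier-Motzkin elimination describes C by finitely many linear inequalities with integer
coefficients.  After replacing negated terms by 1 - x, each of them says that a sum of finitely many
events has value at least m at every point of the cube; then the first m truncations
min 1 (max 0 (x - i)) of the sum x are tautologies, and (P3), which makes P additive, together with
(N) yields the same inequality for the probabilities.  So finitely many theorems of FP force a
valuation of the atoms P(f_i) to come from a state, and finite strong completeness of Lukasiewicz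
logic for [0,1] applies.

The latter is Chang's theorem: a theory not containing a formula extends to a prime one, the chain of
formulas modulo a prime theory embeds into a totally ordered abelian group, and Fourier-Motzkin
elimination transfers a solution of finitely many linear inequalities from that group to the reals.
*)
theory Submission
  imports Defs
begin

section \<open>Theories of \<open>\<turnstile>\<^sub>L\<close>\<close>

text \<open>Consequence over [0,1] in Lukasiewicz logic is not finitary, so completeness is
  available only from finitely many premises, while FP has infinitely many axiom instances. This is
  why every fact about P has the form \<open>fp_entails\<close>, and why the values of states are
  described by finitely many explicit inequalities and not by a general separation argument. All
  inequalities are kept homogeneous, with the value of \<top> as one more variable, and are combined
  with positive integer multiples only. Each is then a comparison of two sums of formulas, which
  makes sense in Chang's group as well, without scaling or division there. Homogeneity also lets
  solutions be added, and that is how the convex hull is described. The truncation in \<oplus> is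
  the only non-linear condition; it becomes linear once it is prescribed which formulas take the
  value 1.\<close>

locale luk_theory =
  fixes T :: "'a form set"
  assumes ax: "luk_axiom \<phi> \<Longrightarrow> \<phi> \<in> T"
    and mp: "\<phi> \<in> T \<Longrightarrow> \<phi> \<^bold>\<rightarrow> \<psi> \<in> T \<Longrightarrow> \<psi> \<in> T"
begin

definition le :: "'a form \<Rightarrow> 'a form \<Rightarrow> bool"  (infix \<open>\<sqsubseteq>\<close> 50)
  where "\<phi> \<sqsubseteq> \<psi> \<longleftrightarrow> \<phi> \<^bold>\<rightarrow> \<psi> \<in> T"

lemma le_mp: "a \<in> T \<Longrightarrow> a \<sqsubseteq> b \<Longrightarrow> b \<in> T"
  unfolding le_def by (rule mp)

lemma axiom1: "a \<sqsubseteq> b \<^bold>\<rightarrow> a"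
  and axiom2: "a \<^bold>\<rightarrow> b \<sqsubseteq> (b \<^bold>\<rightarrow> c) \<^bold>\<rightarrow> (a \<^bold>\<rightarrow> c)"
  and axiom3: "(a \<^bold>\<rightarrow> b) \<^bold>\<rightarrow> b \<sqsubseteq> (b \<^bold>\<rightarrow> a) \<^bold>\<rightarrow> a"
  and axiom4: "\<^bold>\<not> a \<^bold>\<rightarrow> \<^bold>\<not> b \<sqsubseteq> b \<^bold>\<rightarrow> a"
  and bot_le: "\<^bold>\<bottom> \<sqsubseteq> a"
  and plus_le: "a \<^bold>\<oplus> b \<sqsubseteq> \<^bold>\<not> a \<^bold>\<rightarrow> b"
  and le_plus: "\<^bold>\<not> a \<^bold>\<rightarrow> b \<sqsubseteq> a \<^bold>\<oplus> b"
  unfolding le_def by (rule ax luk_axiom.intros)+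

lemma weaken: "a \<in> T \<Longrightarrow> b \<sqsubseteq> a"
  using axiom1 le_mp le_def by metis

lemma le_trans [trans]: "a \<sqsubseteq> b \<Longrightarrow> b \<sqsubseteq> c \<Longrightarrow> a \<sqsubseteq> c"
  using axiom2 mp unfolding le_def by metis

lemma imp_antimono: "a \<sqsubseteq> b \<Longrightarrow> b \<^bold>\<rightarrow> c \<sqsubseteq> a \<^bold>\<rightarrow> c"
  using axiom2 mp unfolding le_def by metis

lemma assertion: "a \<sqsubseteq> (a \<^bold>\<rightarrow> b) \<^bold>\<rightarrow> b"
  using axiom1 axiom3 le_trans by metis

lemma exchange: "a \<sqsubseteq> b \<^bold>\<rightarrow> c \<Longrightarrow> b \<sqsubseteq> a \<^bold>\<rightarrow> c"
  using assertion imp_antimono le_trans by metis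

lemma le_refl [simp]: "a \<sqsubseteq> a"
proof -
  have "a \<sqsubseteq> (a \<^bold>\<rightarrow> a \<^bold>\<rightarrow> a) \<^bold>\<rightarrow> a" by (rule axiom1)
  then have "a \<^bold>\<rightarrow> a \<^bold>\<rightarrow> a \<sqsubseteq> a \<^bold>\<rightarrow> a" by (rule exchange)
  moreover have "a \<^bold>\<rightarrow> a \<^bold>\<rightarrow> a \<in> T" using axiom1 le_def by metis
  ultimately show ?thesis using le_mp le_def by metis
qed

lemma exchange_le: "a \<^bold>\<rightarrow> (b \<^bold>\<rightarrow> c) \<sqsubseteq> b \<^bold>\<rightarrow> (a \<^bold>\<rightarrow> c)"
  using axiom2 imp_antimono[OF assertion] by (rule le_trans)

lemma imp_mono: "b \<sqsubseteq> c \<Longrightarrow> a \<^bold>\<rightarrow> b \<sqsubseteq> a \<^bold>\<rightarrow> c"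
  using exchange[OF axiom2] le_mp le_def by metis

lemma imp_elim: "a \<in> T \<Longrightarrow> a \<^bold>\<rightarrow> b \<sqsubseteq> b"
  using exchange[OF le_refl] le_mp le_def by metis

lemma or_ub1: "a \<sqsubseteq> a \<^bold>\<or> b" and or_ub2: "b \<sqsubseteq> a \<^bold>\<or> b"
  unfolding Or_def by (rule assertion axiom1)+

text \<open>\<open>axiom3\<close> exchanges (c \<rightarrow> b) \<rightarrow> b for (b \<rightarrow>
  c) \<rightarrow> c, which collapses to c because b \<rightarrow> c is in T.\<close>

lemma or_least:
  assumes "a \<sqsubseteq> c" "b \<sqsubseteq> c"
  shows "a \<^bold>\<or> b \<sqsubseteq> c"
proof -
  have "(a \<^bold>\<rightarrow> b) \<^bold>\<rightarrow> b \<sqsubseteq> (c \<^bold>\<rightarrow> b) \<^bold>\<rightarrow> b" using assms by (intro imp_antimono)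
  also have "\<dots> \<sqsubseteq> (b \<^bold>\<rightarrow> c) \<^bold>\<rightarrow> c" by (rule axiom3)
  also have "\<dots> \<sqsubseteq> c" using assms(2) unfolding le_def[of b] by (rule imp_elim)
  finally show ?thesis unfolding Or_def .
qed

lemma neg_le_imp: "\<^bold>\<not> a \<sqsubseteq> a \<^bold>\<rightarrow> b"
  using axiom1 axiom4 by (rule le_trans)

lemma neg_neg_le: "\<^bold>\<not> \<^bold>\<not> a \<sqsubseteq> a"
proof -
  have "\<^bold>\<not> \<^bold>\<not> a \<sqsubseteq> \<^bold>\<not> a \<^bold>\<rightarrow> \<^bold>\<not> (a \<^bold>\<rightarrow> a)" by (rule neg_le_imp)
  also have "\<dots> \<sqsubseteq> (a \<^bold>\<rightarrow> a) \<^bold>\<rightarrow> a" by (rule axiom4)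
  also have "\<dots> \<sqsubseteq> a" using le_refl[unfolded le_def] by (rule imp_elim)
  finally show ?thesis .
qed

lemma le_neg_neg: "a \<sqsubseteq> \<^bold>\<not> \<^bold>\<not> a"
  using le_mp[OF neg_neg_le[unfolded le_def] axiom4] by (simp add: le_def)

lemma contrapos: "a \<^bold>\<rightarrow> b \<sqsubseteq> \<^bold>\<not> b \<^bold>\<rightarrow> \<^bold>\<not> a"
proof -
  have "a \<^bold>\<rightarrow> b \<sqsubseteq> \<^bold>\<not> \<^bold>\<not> a \<^bold>\<rightarrow> b" by (rule imp_antimono[OF neg_neg_le])
  also have "\<dots> \<sqsubseteq> \<^bold>\<not> \<^bold>\<not> a \<^bold>\<rightarrow> \<^bold>\<not> \<^bold>\<not> b" by (rule imp_mono[OF le_neg_neg])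
  also have "\<dots> \<sqsubseteq> \<^bold>\<not> b \<^bold>\<rightarrow> \<^bold>\<not> a" by (rule axiom4)
  finally show ?thesis .
qed

lemma contrapos1: "a \<^bold>\<rightarrow> \<^bold>\<not> b \<sqsubseteq> b \<^bold>\<rightarrow> \<^bold>\<not> a"
  using contrapos imp_antimono[OF le_neg_neg] by (rule le_trans)

lemma contrapos2: "\<^bold>\<not> a \<^bold>\<rightarrow> b \<sqsubseteq> \<^bold>\<not> b \<^bold>\<rightarrow> a"
  using contrapos imp_mono[OF neg_neg_le] by (rule le_trans)

lemma neg_antimono: "a \<sqsubseteq> b \<Longrightarrow> \<^bold>\<not> b \<sqsubseteq> \<^bold>\<not> a"
  and neg_antimono1: "a \<sqsubseteq> \<^bold>\<not> b \<Longrightarrow> b \<sqsubseteq> \<^bold>\<not> a"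
  and neg_antimono2: "\<^bold>\<not> a \<sqsubseteq> b \<Longrightarrow> \<^bold>\<not> b \<sqsubseteq> a"
  using contrapos contrapos1 contrapos2 le_mp unfolding le_def by metis+

text \<open>\<open>\<not> (a \<rightarrow> \<not> b)\<close> is what \<open>a \<odot> b\<close>
  unfolds to; in this form only the laws of implication and negation are needed.\<close>

lemma residuation: "a \<sqsubseteq> b \<^bold>\<rightarrow> c \<Longrightarrow> \<^bold>\<not> (a \<^bold>\<rightarrow> \<^bold>\<not> b) \<sqsubseteq> c"
proof (rule neg_antimono2)
  assume "a \<sqsubseteq> b \<^bold>\<rightarrow> c"
  then have "a \<sqsubseteq> \<^bold>\<not> c \<^bold>\<rightarrow> \<^bold>\<not> b" using contrapos by (rule le_trans)
  then show "\<^bold>\<not> c \<sqsubseteq> a \<^bold>\<rightarrow> \<^bold>\<not> b" by (rule exchange)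
qed

lemma residuation_le: "a \<^bold>\<rightarrow> (b \<^bold>\<rightarrow> c) \<sqsubseteq> \<^bold>\<not> (a \<^bold>\<rightarrow> \<^bold>\<not> b) \<^bold>\<rightarrow> c"
  by (rule exchange, rule residuation, rule le_trans[OF assertion exchange_le])

text \<open>In [0,1] the right-hand side \<open>b \<odot> (b \<rightarrow> a)\<close> is min a b.
  Contraposition reduces the claim to the fact that the join of \<not> a and \<not> b is \<not>
  a.\<close>

lemma divisible: "a \<sqsubseteq> b \<Longrightarrow> a \<sqsubseteq> \<^bold>\<not> (b \<^bold>\<rightarrow> \<^bold>\<not> (b \<^bold>\<rightarrow> a))"
proof (rule neg_antimono1)
  assume "a \<sqsubseteq> b"
  have "b \<^bold>\<rightarrow> \<^bold>\<not> (b \<^bold>\<rightarrow> a) \<sqsubseteq> (b \<^bold>\<rightarrow> a) \<^bold>\<rightarrow> \<^bold>\<not> b" by (rule contrapos1)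
  also have "\<dots> \<sqsubseteq> (\<^bold>\<not> a \<^bold>\<rightarrow> \<^bold>\<not> b) \<^bold>\<rightarrow> \<^bold>\<not> b" by (rule imp_antimono[OF axiom4])
  also have "\<dots> \<sqsubseteq> \<^bold>\<not> a"
    using or_least[OF le_refl neg_antimono[OF \<open>a \<sqsubseteq> b\<close>]] by (simp add: Or_def)
  finally show "b \<^bold>\<rightarrow> \<^bold>\<not> (b \<^bold>\<rightarrow> a) \<sqsubseteq> \<^bold>\<not> a" .
qed

text \<open>Commutativity of the meet \<open>c \<odot> (c \<rightarrow> a)\<close>, read through residuation.\<close>

lemma imp_imp_swap: "(c \<^bold>\<rightarrow> a) \<^bold>\<rightarrow> (c \<^bold>\<rightarrow> b) \<sqsubseteq> (a \<^bold>\<rightarrow> c) \<^bold>\<rightarrow> (a \<^bold>\<rightarrow> b)"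
proof -
  have "(c \<^bold>\<rightarrow> a) \<^bold>\<rightarrow> (c \<^bold>\<rightarrow> b) \<sqsubseteq> (\<^bold>\<not> a \<^bold>\<rightarrow> \<^bold>\<not> c) \<^bold>\<rightarrow> (c \<^bold>\<rightarrow> b)"
    by (rule imp_antimono[OF axiom4])
  also have "\<dots> \<sqsubseteq> (\<^bold>\<not> a \<^bold>\<rightarrow> \<^bold>\<not> c) \<^bold>\<rightarrow> (\<^bold>\<not> b \<^bold>\<rightarrow> \<^bold>\<not> c)" by (rule imp_mono[OF contrapos])
  also have "\<dots> \<sqsubseteq> \<^bold>\<not> b \<^bold>\<rightarrow> ((\<^bold>\<not> a \<^bold>\<rightarrow> \<^bold>\<not> c) \<^bold>\<rightarrow> \<^bold>\<not> c)" by (rule exchange_le)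
  also have "\<dots> \<sqsubseteq> \<^bold>\<not> b \<^bold>\<rightarrow> ((\<^bold>\<not> c \<^bold>\<rightarrow> \<^bold>\<not> a) \<^bold>\<rightarrow> \<^bold>\<not> a)" by (rule imp_mono[OF axiom3])
  also have "\<dots> \<sqsubseteq> (\<^bold>\<not> c \<^bold>\<rightarrow> \<^bold>\<not> a) \<^bold>\<rightarrow> (\<^bold>\<not> b \<^bold>\<rightarrow> \<^bold>\<not> a)" by (rule exchange_le)
  also have "\<dots> \<sqsubseteq> (a \<^bold>\<rightarrow> c) \<^bold>\<rightarrow> (\<^bold>\<not> b \<^bold>\<rightarrow> \<^bold>\<not> a)" by (rule imp_antimono[OF contrapos])
  also have "\<dots> \<sqsubseteq> (a \<^bold>\<rightarrow> c) \<^bold>\<rightarrow> (a \<^bold>\<rightarrow> b)" by (rule imp_mono[OF axiom4])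
  finally show ?thesis .
qed

lemma prelinear: "(a \<^bold>\<rightarrow> b) \<^bold>\<or> (b \<^bold>\<rightarrow> a) \<in> T"
proof -
  let ?X = "a \<^bold>\<rightarrow> b" and ?Y = "b \<^bold>\<rightarrow> a"
  \<comment> \<open>With this \<open>?c\<close> both b \<sqsubseteq> \<open>?c\<close> and
    \<open>?Y\<close> \<sqsubseteq> \<open>?c\<close> \<rightarrow> b hold, so \<open>?c\<close>
    \<rightarrow> a \<sqsubseteq> \<open>?c\<close> \<rightarrow> b. \<open>imp_imp_swap\<close>
    turns this into a \<rightarrow> \<open>?c\<close> \<sqsubseteq> \<open>?X\<close>, and a
    \<rightarrow> \<open>?c\<close> is \<open>?Y\<close> \<rightarrow> \<open>?X\<close> up to
    exchange.\<close>
  let ?c = "?Y \<^bold>\<rightarrow> b"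
  have "?c \<^bold>\<rightarrow> a \<sqsubseteq> ?Y" by (rule imp_antimono[OF axiom1])
  also have "?Y \<sqsubseteq> ?c \<^bold>\<rightarrow> b" by (rule assertion)
  finally have "a \<^bold>\<rightarrow> ?c \<sqsubseteq> ?X" using imp_imp_swap le_mp unfolding le_def by metis
  with exchange_le have "?Y \<^bold>\<rightarrow> ?X \<sqsubseteq> ?X" by (rule le_trans)
  with axiom3 show ?thesis unfolding Or_def le_def using mp by metis
qed

lemma or_comm: "a \<^bold>\<or> b \<in> T \<Longrightarrow> b \<^bold>\<or> a \<in> T"
  using le_mp or_least or_ub1 or_ub2 by metis

lemma or_mp:
  assumes "a \<^bold>\<or> c \<in> T" "(a \<^bold>\<rightarrow> b) \<^bold>\<or> c \<in> T"
  shows "b \<^bold>\<or> c \<in> T"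
proof -
  have "a \<sqsubseteq> (a \<^bold>\<rightarrow> b) \<^bold>\<rightarrow> (b \<^bold>\<or> c)" using assertion imp_mono[OF or_ub1] by (rule le_trans)
  moreover have "c \<sqsubseteq> (a \<^bold>\<rightarrow> b) \<^bold>\<rightarrow> (b \<^bold>\<or> c)" using or_ub2 axiom1 by (rule le_trans)
  ultimately have "a \<^bold>\<rightarrow> b \<sqsubseteq> b \<^bold>\<or> c" using assms(1) or_least le_mp le_def by metis
  then show ?thesis using assms(2) or_ub2 or_least le_mp by metis
qed

end

section \<open>Derivations from premises and the existence of prime theories\<close>

inductive luk_deriv :: "'a form set \<Rightarrow> 'a form \<Rightarrow> bool" for \<Gamma> where
  hyp: "\<phi> \<in> \<Gamma> \<Longrightarrow> luk_deriv \<Gamma> \<phi>"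
| ax: "luk_axiom \<phi> \<Longrightarrow> luk_deriv \<Gamma> \<phi>"
| mp: "luk_deriv \<Gamma> \<phi> \<Longrightarrow> luk_deriv \<Gamma> (\<phi> \<^bold>\<rightarrow> \<psi>) \<Longrightarrow> luk_deriv \<Gamma> \<psi>"

lemma luk_theory_deriv: "luk_theory {\<phi>. luk_deriv \<Gamma> \<phi>}"
  by unfold_locales (auto intro: luk_deriv.intros)

lemma luk_deriv_empty: "luk_deriv {} \<phi> \<longleftrightarrow> \<turnstile>\<^sub>L \<phi>"
proof
  show "luk_deriv {} \<phi> \<Longrightarrow> \<turnstile>\<^sub>L \<phi>"
    by (induction rule: luk_deriv.induct) (auto intro: luk_thm.intros)
  show "\<turnstile>\<^sub>L \<phi> \<Longrightarrow> luk_deriv {} \<phi>"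
    by (induction rule: luk_thm.induct) (auto intro: luk_deriv.intros)
qed

text \<open>Reasoning by cases: disjoining \<open>\<psi>\<close> to every line of a derivation
  preserves modus ponens by \<open>or_mp\<close>. This replaces the deduction theorem, which in this
  logic holds only with powers of the hypothesis.\<close>

lemma luk_deriv_or:
  assumes "luk_deriv (insert \<eta> \<Gamma>) \<delta>" "luk_theory T" "\<Gamma> \<subseteq> T" "\<eta> \<^bold>\<or> \<psi> \<in> T"
  shows "\<delta> \<^bold>\<or> \<psi> \<in> T"
proof -
  interpret luk_theory T by fact
  have weak: "\<delta> \<^bold>\<or> \<psi> \<in> T" if "\<delta> \<in> T" for \<delta> using that or_ub1 le_mp by blast
  from assms(1) show ?thesis
  proof (induction rule: luk_deriv.induct)
    case (hyp \<delta>)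
    then show ?case using assms(3,4) weak by blast
  next
    case (ax \<delta>)
    then show ?case by (intro weak luk_theory.ax[OF assms(2)])
  next
    case (mp \<delta> \<epsilon>)
    then show ?case using or_mp by metis
  qed
qed

locale prime_theory = luk_theory +
  assumes consistent: "\<^bold>\<bottom> \<notin> T"
    and total: "a \<sqsubseteq> b \<or> b \<sqsubseteq> a"

lemma prime_theory_exists:
  assumes "\<not> luk_deriv \<Gamma> \<phi>"
  obtains T where "prime_theory T" "\<Gamma> \<subseteq> T" "\<phi> \<notin> T"
proof -
  define A where "A = {T. luk_theory T \<and> \<Gamma> \<subseteq> T \<and> \<phi> \<notin> T}"
  have "{\<phi>. luk_deriv \<Gamma> \<phi>} \<in> A"
    using assms luk_theory_deriv by (auto simp: A_def intro: luk_deriv.hyp)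
  moreover have "\<Union>C \<in> A" if C: "C \<noteq> {}" "subset.chain A C" for C
  proof -
    have "luk_theory (\<Union>C)"
    proof
      show "\<phi> \<in> \<Union>C" if "luk_axiom \<phi>" for \<phi>
      proof -
        obtain X where "X \<in> C" using C by blast
        moreover from this have "luk_theory X" using C by (auto simp: A_def subset_chain_def)
        ultimately show ?thesis using that luk_theory.ax by blast
      qed
      fix \<phi> \<psi> assume "\<phi> \<in> \<Union>C" "\<phi> \<^bold>\<rightarrow> \<psi> \<in> \<Union>C"
      then obtain X Y where XY: "X \<in> C" "\<phi> \<in> X" "Y \<in> C" "\<phi> \<^bold>\<rightarrow> \<psi> \<in> Y" by blast
      then have "X \<subseteq> Y \<or> Y \<subseteq> X" using C by (auto simp: subset_chain_def)
      then obtain Z where "Z \<in> C" "\<phi> \<in> Z" "\<phi> \<^bold>\<rightarrow> \<psi> \<in> Z" using XY by blast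
      moreover have "luk_theory Z" using \<open>Z \<in> C\<close> C by (auto simp: A_def subset_chain_def)
      ultimately show "\<psi> \<in> \<Union>C" using luk_theory.mp by blast
    qed
    then show ?thesis using C by (auto simp: A_def subset_chain_def)
  qed
  ultimately obtain T where T: "T \<in> A" and max: "\<And>X. X \<in> A \<Longrightarrow> T \<subseteq> X \<Longrightarrow> X = T"
    using subset_Zorn_nonempty[of A] by blast
  interpret luk_theory T using T by (simp add: A_def)
  have ext: "luk_deriv (insert \<eta> T) \<phi>" if "\<eta> \<notin> T" for \<eta>
  proof (rule ccontr)
    assume "\<not> ?thesis"
    then have "{\<delta>. luk_deriv (insert \<eta> T) \<delta>} \<in> A"
      using T luk_theory_deriv by (auto simp: A_def intro: luk_deriv.hyp)
    then have "{\<delta>. luk_deriv (insert \<eta> T) \<delta>} = T"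
      by (rule max) (auto intro: luk_deriv.hyp)
    then show False using that by (auto intro: luk_deriv.hyp)
  qed
  have "prime_theory T"
  proof
    show "\<^bold>\<bottom> \<notin> T" using T bot_le le_mp by (auto simp: A_def)
    fix a b show "le a b \<or> le b a"
    proof (rule ccontr)
      assume "\<not> ?thesis"
      then have "a \<^bold>\<rightarrow> b \<notin> T" "b \<^bold>\<rightarrow> a \<notin> T" by (auto simp: le_def)
      then have "luk_deriv (insert (a \<^bold>\<rightarrow> b) T) \<phi>" "luk_deriv (insert (b \<^bold>\<rightarrow> a) T) \<phi>"
        using ext by auto
      \<comment> \<open>\<open>luk_deriv_or\<close> is used twice on the prelinearity disjunction:
        it replaces one disjunct by \<open>\<phi>\<close> and then, after \<open>or_comm\<close>,
        the other.\<close>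
      then have "\<phi> \<^bold>\<or> \<phi> \<in> T"
        using luk_deriv_or[OF _ luk_theory_axioms order_refl] prelinear or_comm by blast
      then have "\<phi> \<in> T" using or_least le_mp le_refl by blast
      then show False using T by (simp add: A_def)
    qed
  qed
  then show ?thesis using that T by (auto simp: A_def)
qed

section \<open>Chang's group of a prime theory\<close>

context prime_theory
begin

definition rep :: "'a form \<Rightarrow> 'a form"
  where "rep a = (SOME b. a \<sqsubseteq> b \<and> b \<sqsubseteq> a)"

lemma rep_equiv: "a \<sqsubseteq> rep a" "rep a \<sqsubseteq> a"
  unfolding rep_def using someI[of "\<lambda>b. a \<sqsubseteq> b \<and> b \<sqsubseteq> a" a] by auto

lemma rep_cong: "a \<sqsubseteq> b \<Longrightarrow> b \<sqsubseteq> a \<Longrightarrow> rep a = rep b"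
  unfolding rep_def using le_trans by metis

lemma rep_rep [simp]: "rep (rep a) = rep a"
  using rep_equiv by (intro rep_cong)

lemma le_rep_iff [simp]: "b \<sqsubseteq> rep a \<longleftrightarrow> b \<sqsubseteq> a"
  and rep_le_iff [simp]: "rep a \<sqsubseteq> b \<longleftrightarrow> a \<sqsubseteq> b"
  using rep_equiv le_trans by metis+

lemma rep_in_iff [simp]: "rep a \<in> T \<longleftrightarrow> a \<in> T"
  using rep_equiv le_mp by metis

lemma rep_imp_rep [simp]: "rep (b \<^bold>\<rightarrow> rep a) = rep (b \<^bold>\<rightarrow> a)"
  and rep_neg_rep_imp [simp]: "rep (\<^bold>\<not> (rep a \<^bold>\<rightarrow> b)) = rep (\<^bold>\<not> (a \<^bold>\<rightarrow> b))"
  by (intro rep_cong imp_mono neg_antimono imp_antimono rep_equiv)+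

text \<open>
  The pair \<open>(n, a)\<close> with \<open>a \<notin> T\<close> stands for the element \<open>n + a\<close> of Chang's ordered group of the
  chain of formulas modulo \<open>T\<close>, and \<open>add_neg p\<close> adds \<open>1 - p\<close> to it.  Remainders are normalised
  by \<open>rep\<close> so that equivalent formulas give equal pairs.
\<close>

definition add_neg :: "'a form \<Rightarrow> nat \<times> 'a form \<Rightarrow> nat \<times> 'a form" where
  "add_neg p x =
    (if snd x \<in> T then x
     else if p \<sqsubseteq> snd x then (Suc (fst x), rep (\<^bold>\<not> (snd x \<^bold>\<rightarrow> p)))
     else (fst x, rep (p \<^bold>\<rightarrow> snd x)))"

text \<open>\<open>\<not> (a \<rightarrow> p)\<close> is the difference a - p that
  \<open>add_neg\<close> leaves after a carry; \<open>p \<rightarrow> a\<close> is 1 - p + a, left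
  when there is no carry. Both remainders have to stay outside T.\<close>

lemma neg_imp_le: "\<^bold>\<not> (a \<^bold>\<rightarrow> p) \<sqsubseteq> a"
  by (rule neg_antimono2[OF neg_le_imp])

lemma neg_imp_notin: "a \<notin> T \<Longrightarrow> \<^bold>\<not> (a \<^bold>\<rightarrow> p) \<notin> T"
  using neg_imp_le le_mp by blast

lemma add_neg_notin [simp]: "snd (add_neg p x) \<in> T \<longleftrightarrow> snd x \<in> T"
  by (simp add: add_neg_def neg_imp_notin) (simp add: le_def)

text \<open>This and the next three lemmas make the remainders of a + (1 - p) + (1 - q) independent
  of the order, one lemma for each pattern of carries: only the second addition carries, only the
  first does, both do, and finally the mixed case where adding 1 - q carries in either order and
  adding 1 - p never does.\<close>

lemma imp_imp_exchange:
  assumes "a \<sqsubseteq> p" "a \<sqsubseteq> q"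
  shows "(p \<^bold>\<rightarrow> a) \<^bold>\<rightarrow> q \<sqsubseteq> (q \<^bold>\<rightarrow> a) \<^bold>\<rightarrow> p"
proof -
  have "(p \<^bold>\<rightarrow> a) \<^bold>\<rightarrow> q \<sqsubseteq> (p \<^bold>\<rightarrow> a) \<^bold>\<rightarrow> ((q \<^bold>\<rightarrow> a) \<^bold>\<rightarrow> a)" by (rule imp_mono[OF assertion])
  also have "\<dots> \<sqsubseteq> (q \<^bold>\<rightarrow> a) \<^bold>\<rightarrow> ((p \<^bold>\<rightarrow> a) \<^bold>\<rightarrow> a)" by (rule exchange_le)
  also have "\<dots> \<sqsubseteq> (q \<^bold>\<rightarrow> a) \<^bold>\<rightarrow> p"
    using or_least[OF le_refl assms(1)] by (intro imp_mono) (simp add: Or_def)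
  finally show ?thesis .
qed

lemma imp_neg_imp_exchange:
  assumes "p \<sqsubseteq> a" "q \<sqsubseteq> a"
  shows "q \<^bold>\<rightarrow> \<^bold>\<not> (a \<^bold>\<rightarrow> p) \<sqsubseteq> p \<^bold>\<rightarrow> \<^bold>\<not> (a \<^bold>\<rightarrow> q)"
proof -
  have "q \<^bold>\<rightarrow> \<^bold>\<not> (a \<^bold>\<rightarrow> p) \<sqsubseteq> (a \<^bold>\<rightarrow> p) \<^bold>\<rightarrow> \<^bold>\<not> q" by (rule contrapos1)
  also have "\<dots> \<sqsubseteq> (\<^bold>\<not> p \<^bold>\<rightarrow> \<^bold>\<not> a) \<^bold>\<rightarrow> \<^bold>\<not> q" by (rule imp_antimono[OF axiom4])
  also have "\<dots> \<sqsubseteq> (\<^bold>\<not> q \<^bold>\<rightarrow> \<^bold>\<not> a) \<^bold>\<rightarrow> \<^bold>\<not> p"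
    using assms by (intro imp_imp_exchange neg_antimono)
  also have "\<dots> \<sqsubseteq> (a \<^bold>\<rightarrow> q) \<^bold>\<rightarrow> \<^bold>\<not> p" by (rule imp_antimono[OF contrapos])
  also have "\<dots> \<sqsubseteq> p \<^bold>\<rightarrow> \<^bold>\<not> (a \<^bold>\<rightarrow> q)" by (rule contrapos1)
  finally show ?thesis .
qed

lemma neg_imp_imp_exchange: "\<^bold>\<not> (a \<^bold>\<rightarrow> p) \<^bold>\<rightarrow> q \<sqsubseteq> \<^bold>\<not> (a \<^bold>\<rightarrow> q) \<^bold>\<rightarrow> p"
proof -
  have "\<^bold>\<not> (a \<^bold>\<rightarrow> p) \<^bold>\<rightarrow> q \<sqsubseteq> \<^bold>\<not> q \<^bold>\<rightarrow> (a \<^bold>\<rightarrow> p)" by (rule contrapos2)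
  also have "\<dots> \<sqsubseteq> \<^bold>\<not> q \<^bold>\<rightarrow> (\<^bold>\<not> p \<^bold>\<rightarrow> \<^bold>\<not> a)" by (rule imp_mono[OF contrapos])
  also have "\<dots> \<sqsubseteq> \<^bold>\<not> p \<^bold>\<rightarrow> (\<^bold>\<not> q \<^bold>\<rightarrow> \<^bold>\<not> a)" by (rule exchange_le)
  also have "\<dots> \<sqsubseteq> \<^bold>\<not> p \<^bold>\<rightarrow> (a \<^bold>\<rightarrow> q)" by (rule imp_mono[OF axiom4])
  also have "\<dots> \<sqsubseteq> \<^bold>\<not> (a \<^bold>\<rightarrow> q) \<^bold>\<rightarrow> p" by (rule contrapos2)
  finally show ?thesis .
qed

lemma neg_imp_eq_imp_neg:
  assumes "q \<sqsubseteq> a" "a \<sqsubseteq> p"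
  shows "\<^bold>\<not> ((p \<^bold>\<rightarrow> a) \<^bold>\<rightarrow> q) \<sqsubseteq> p \<^bold>\<rightarrow> \<^bold>\<not> (a \<^bold>\<rightarrow> q)"
    and "p \<^bold>\<rightarrow> \<^bold>\<not> (a \<^bold>\<rightarrow> q) \<sqsubseteq> \<^bold>\<not> ((p \<^bold>\<rightarrow> a) \<^bold>\<rightarrow> q)"
proof -
  let ?y = "(p \<^bold>\<rightarrow> a) \<^bold>\<rightarrow> q"
  have "p \<sqsubseteq> (p \<^bold>\<rightarrow> a) \<^bold>\<rightarrow> a" by (rule assertion)
  also have "\<dots> \<sqsubseteq> (a \<^bold>\<rightarrow> q) \<^bold>\<rightarrow> ?y" by (rule axiom2)
  finally have "\<^bold>\<not> (p \<^bold>\<rightarrow> \<^bold>\<not> (a \<^bold>\<rightarrow> q)) \<sqsubseteq> ?y" by (rule residuation)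
  then show "\<^bold>\<not> ?y \<sqsubseteq> p \<^bold>\<rightarrow> \<^bold>\<not> (a \<^bold>\<rightarrow> q)" by (rule neg_antimono2)
  \<comment> \<open>For the converse, \<open>?y\<close> lies below p and therefore factors as
    \<open>p \<odot> (p \<rightarrow> ?y)\<close>; it remains to bound the second factor by a
    \<rightarrow> q.\<close>
  have "?y \<sqsubseteq> (p \<^bold>\<rightarrow> a) \<^bold>\<rightarrow> a" using assms(1) by (rule imp_mono)
  also have "\<dots> \<sqsubseteq> p" using or_least[OF le_refl assms(2)] by (simp add: Or_def)
  finally have "?y \<sqsubseteq> \<^bold>\<not> (p \<^bold>\<rightarrow> \<^bold>\<not> (p \<^bold>\<rightarrow> ?y))" by (rule divisible)
  moreover have "p \<^bold>\<rightarrow> ?y \<sqsubseteq> a \<^bold>\<rightarrow> q"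
    using residuation_le imp_antimono[OF divisible[OF assms(2)]] by (rule le_trans)
  then have "\<^bold>\<not> (p \<^bold>\<rightarrow> \<^bold>\<not> (p \<^bold>\<rightarrow> ?y)) \<sqsubseteq> \<^bold>\<not> (p \<^bold>\<rightarrow> \<^bold>\<not> (a \<^bold>\<rightarrow> q))"
    by (intro neg_antimono imp_mono)
  ultimately have "?y \<sqsubseteq> \<^bold>\<not> (p \<^bold>\<rightarrow> \<^bold>\<not> (a \<^bold>\<rightarrow> q))" by (rule le_trans)
  then show "p \<^bold>\<rightarrow> \<^bold>\<not> (a \<^bold>\<rightarrow> q) \<sqsubseteq> \<^bold>\<not> ?y" by (rule neg_antimono1)
qed

lemma not_le: "\<not> a \<sqsubseteq> b \<Longrightarrow> b \<sqsubseteq> a"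
  using total by blast

lemma add_neg_commute_mixed:
  assumes "a \<notin> T" "\<not> p \<sqsubseteq> a" "q \<sqsubseteq> a"
  shows "add_neg q (add_neg p (n, a)) = add_neg p (add_neg q (n, a))"
proof -
  note eq = neg_imp_eq_imp_neg[OF assms(3) not_le[OF assms(2)]]
  have "p \<^bold>\<rightarrow> a \<notin> T" using assms(2) by (simp add: le_def)
  moreover have "q \<sqsubseteq> p \<^bold>\<rightarrow> a" using assms(3) axiom1 by (rule le_trans)
  \<comment> \<open>If adding 1 - p after 1 - q carried too, p \<rightarrow> (a - q) would lie in T,
    and \<open>eq\<close> with \<open>neg_imp_le\<close> would put p \<rightarrow> a into T.\<close>
  moreover have "\<not> p \<sqsubseteq> \<^bold>\<not> (a \<^bold>\<rightarrow> q)"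
    using eq(2) \<open>p \<^bold>\<rightarrow> a \<notin> T\<close> le_mp neg_imp_le unfolding le_def[of p] by blast
  moreover have "rep (\<^bold>\<not> ((p \<^bold>\<rightarrow> a) \<^bold>\<rightarrow> q)) = rep (p \<^bold>\<rightarrow> \<^bold>\<not> (a \<^bold>\<rightarrow> q))"
    using eq by (rule rep_cong)
  ultimately show ?thesis
    using assms by (simp add: add_neg_def neg_imp_notin)
qed

lemma add_neg_commute: "add_neg q (add_neg p x) = add_neg p (add_neg q x)"
proof (cases "snd x \<in> T")
  case True
  then show ?thesis by (simp add: add_neg_def)
next
  case False
  obtain n a where x: "x = (n, a)" by fastforce
  with False have a: "a \<notin> T" by simp
  consider "\<not> p \<sqsubseteq> a" "\<not> q \<sqsubseteq> a" | "p \<sqsubseteq> a" "q \<sqsubseteq> a" | "\<not> p \<sqsubseteq> a" "q \<sqsubseteq> a" | "p \<sqsubseteq> a" "\<not> q \<sqsubseteq> a"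
    by blast
  then show ?thesis
  proof cases
    case 1
    then have "p \<^bold>\<rightarrow> a \<notin> T" "q \<^bold>\<rightarrow> a \<notin> T" by (auto simp: le_def)
    moreover have "q \<sqsubseteq> p \<^bold>\<rightarrow> a \<longleftrightarrow> p \<sqsubseteq> q \<^bold>\<rightarrow> a" using exchange by blast
    moreover have "rep (q \<^bold>\<rightarrow> (p \<^bold>\<rightarrow> a)) = rep (p \<^bold>\<rightarrow> (q \<^bold>\<rightarrow> a))"
      by (intro rep_cong exchange_le)
    moreover have "rep (\<^bold>\<not> ((p \<^bold>\<rightarrow> a) \<^bold>\<rightarrow> q)) = rep (\<^bold>\<not> ((q \<^bold>\<rightarrow> a) \<^bold>\<rightarrow> p))"
      using 1 not_le by (intro rep_cong neg_antimono imp_imp_exchange) auto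
    ultimately show ?thesis using 1 a by (simp add: x add_neg_def)
  next
    case 2
    note eq = imp_neg_imp_exchange[OF 2] imp_neg_imp_exchange[OF 2(2) 2(1)]
    have "q \<sqsubseteq> \<^bold>\<not> (a \<^bold>\<rightarrow> p) \<longleftrightarrow> p \<sqsubseteq> \<^bold>\<not> (a \<^bold>\<rightarrow> q)"
      using eq le_mp unfolding le_def[of q] le_def[of p] by blast
    moreover have "rep (q \<^bold>\<rightarrow> \<^bold>\<not> (a \<^bold>\<rightarrow> p)) = rep (p \<^bold>\<rightarrow> \<^bold>\<not> (a \<^bold>\<rightarrow> q))"
      using eq by (rule rep_cong)
    moreover have "rep (\<^bold>\<not> (\<^bold>\<not> (a \<^bold>\<rightarrow> p) \<^bold>\<rightarrow> q)) = rep (\<^bold>\<not> (\<^bold>\<not> (a \<^bold>\<rightarrow> q) \<^bold>\<rightarrow> p))"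
      by (intro rep_cong neg_antimono neg_imp_imp_exchange)
    ultimately show ?thesis using 2 a by (simp add: x add_neg_def neg_imp_notin)
  next
    case 3
    with a show ?thesis unfolding x by (rule add_neg_commute_mixed)
  next
    case 4
    with a show ?thesis unfolding x by (intro add_neg_commute_mixed[symmetric])
  qed
qed

text \<open>Adding 1 - p and then p adds exactly 1, because exactly one of the two additions
  carries. This stands in for subtraction and is the source of
  \<open>mset_le_cancel\<close>.\<close>

lemma add_neg_cancel:
  assumes "snd x \<notin> T" "rep (snd x) = snd x"
  shows "add_neg (\<^bold>\<not> p) (add_neg p x) = (Suc (fst x), snd x)"
proof -
  obtain n a where x: "x = (n, a)" by fastforce
  have a: "a \<notin> T" "rep a = a" using assms by (auto simp: x)
  show ?thesis
  proof (cases "p \<sqsubseteq> a")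
    case True
    have "\<^bold>\<not> p \<^bold>\<rightarrow> \<^bold>\<not> (a \<^bold>\<rightarrow> p) \<sqsubseteq> (a \<^bold>\<rightarrow> p) \<^bold>\<rightarrow> p" by (rule axiom4)
    also have "\<dots> \<sqsubseteq> a" using or_least[OF le_refl True] by (simp add: Or_def)
    finally have 1: "\<^bold>\<not> p \<^bold>\<rightarrow> \<^bold>\<not> (a \<^bold>\<rightarrow> p) \<sqsubseteq> a" .
    then have "\<not> \<^bold>\<not> p \<sqsubseteq> \<^bold>\<not> (a \<^bold>\<rightarrow> p)" using a le_mp unfolding le_def[of "\<^bold>\<not> p"] by blast
    moreover have "a \<sqsubseteq> \<^bold>\<not> p \<^bold>\<rightarrow> \<^bold>\<not> (a \<^bold>\<rightarrow> p)"
      using assertion contrapos by (rule le_trans)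
    then have "rep (\<^bold>\<not> p \<^bold>\<rightarrow> \<^bold>\<not> (a \<^bold>\<rightarrow> p)) = a" using 1 a(2) rep_cong by metis
    ultimately show ?thesis using True a by (simp add: x add_neg_def neg_imp_notin)
  next
    case False
    then have "p \<^bold>\<rightarrow> a \<notin> T" by (simp add: le_def)
    have "\<^bold>\<not> ((p \<^bold>\<rightarrow> a) \<^bold>\<rightarrow> \<^bold>\<not> p) \<sqsubseteq> \<^bold>\<not> (p \<^bold>\<rightarrow> \<^bold>\<not> (p \<^bold>\<rightarrow> a))"
      by (rule neg_antimono[OF contrapos1])
    also have "\<dots> \<sqsubseteq> a" by (rule residuation[OF assertion])
    finally have "\<^bold>\<not> ((p \<^bold>\<rightarrow> a) \<^bold>\<rightarrow> \<^bold>\<not> p) \<sqsubseteq> a" .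
    moreover have "a \<sqsubseteq> \<^bold>\<not> ((p \<^bold>\<rightarrow> a) \<^bold>\<rightarrow> \<^bold>\<not> p)"
      using divisible[OF not_le[OF False]] neg_antimono[OF contrapos1] by (rule le_trans)
    ultimately have "rep (\<^bold>\<not> ((p \<^bold>\<rightarrow> a) \<^bold>\<rightarrow> \<^bold>\<not> p)) = a" using a(2) rep_cong by metis
    then show ?thesis using False a \<open>p \<^bold>\<rightarrow> a \<notin> T\<close> neg_le_imp by (simp add: x add_neg_def)
  qed
qed

section \<open>The order of Chang's group and sums of multisets of formulas\<close>

definition pair_le :: "nat \<times> 'a form \<Rightarrow> nat \<times> 'a form \<Rightarrow> bool"
  where "pair_le x y \<longleftrightarrow> fst x < fst y \<or> fst x = fst y \<and> snd x \<sqsubseteq> snd y"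

lemma pair_le_refl [simp]: "pair_le x x"
  by (simp add: pair_le_def)

lemma pair_le_trans: "pair_le x y \<Longrightarrow> pair_le y z \<Longrightarrow> pair_le x z"
  unfolding pair_le_def using le_trans by (metis order_less_trans)

lemma pair_le_add_neg: "pair_le x (add_neg p x)"
  by (simp add: pair_le_def add_neg_def axiom1)

lemma add_neg_mono:
  assumes "pair_le x y" "snd x \<notin> T" "snd y \<notin> T"
  shows "pair_le (add_neg p x) (add_neg p y)"
proof -
  obtain n a m b where [simp]: "x = (n, a)" "y = (m, b)" by fastforce
  have ab: "n < m \<or> n = m \<and> a \<sqsubseteq> b" using assms(1) by (simp add: pair_le_def)
  \<comment> \<open>Needed when only the left side carries and m is n + 1: both counters are then
    equal, and a - p must lie below p \<rightarrow> b. The two are separated by \<not> p.\<close>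
  have "\<^bold>\<not> (a \<^bold>\<rightarrow> p) \<sqsubseteq> p \<^bold>\<rightarrow> b"
    using neg_antimono[OF axiom1] neg_le_imp by (rule le_trans)
  moreover have "p \<sqsubseteq> b" if "p \<sqsubseteq> a" "a \<sqsubseteq> b" using that by (rule le_trans)
  moreover have "p \<^bold>\<rightarrow> a \<sqsubseteq> p \<^bold>\<rightarrow> b" "\<^bold>\<not> (a \<^bold>\<rightarrow> p) \<sqsubseteq> \<^bold>\<not> (b \<^bold>\<rightarrow> p)" if "a \<sqsubseteq> b"
    using that by (auto intro: imp_mono neg_antimono imp_antimono)
  ultimately show ?thesis using ab assms(2,3) by (auto simp: pair_le_def add_neg_def)
qed

sublocale add: comp_fun_commute "\<lambda>a. add_neg (\<^bold>\<not> a)"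
  by standard (auto simp: fun_eq_iff intro: add_neg_commute)

text \<open>Only finite sums of formulas and their comparison are needed from Chang's group, so
  folding the commuting maps \<open>add_neg\<close> over a multiset replaces a construction of the
  group. A formula a is added as 1 - (1 - a).\<close>

definition mset_val :: "'a form multiset \<Rightarrow> nat \<times> 'a form"
  where "mset_val M = fold_mset (\<lambda>a. add_neg (\<^bold>\<not> a)) (0, rep \<^bold>\<bottom>) M"

lemma mset_val_empty: "mset_val {#} = (0, rep \<^bold>\<bottom>)"
  by (simp add: mset_val_def)

lemma mset_val_add: "mset_val (add_mset a M) = add_neg (\<^bold>\<not> a) (mset_val M)"
  by (simp add: mset_val_def)

lemma mset_val_notin: "snd (mset_val M) \<notin> T"
  by (induction M) (simp_all add: mset_val_empty mset_val_add consistent)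

lemma rep_mset_val: "rep (snd (mset_val M)) = snd (mset_val M)"
proof (induction M)
  case (add a M)
  then show ?case by (simp add: mset_val_add add_neg_def)
qed (simp add: mset_val_empty)

definition mset_le :: "'a form multiset \<Rightarrow> 'a form multiset \<Rightarrow> bool"  (infix \<open>\<preceq>\<close> 50)
  where "M \<preceq> N \<longleftrightarrow> pair_le (mset_val M) (mset_val N)"

lemma mset_le_refl [simp]: "M \<preceq> M"
  by (simp add: mset_le_def)

lemma mset_le_trans: "L \<preceq> M \<Longrightarrow> M \<preceq> N \<Longrightarrow> L \<preceq> N"
  unfolding mset_le_def by (rule pair_le_trans)

lemma mset_le_add_right: "M \<preceq> N \<Longrightarrow> M + K \<preceq> N + K"
  by (induction K) (auto simp: mset_le_def mset_val_add mset_val_notin intro!: add_neg_mono)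

lemma mset_le_add_mono: "M \<preceq> N \<Longrightarrow> M' \<preceq> N' \<Longrightarrow> M + M' \<preceq> N + N'"
  using mset_le_trans[of "M + M'" "N + M'" "N + N'"] mset_le_add_right[of M N M']
    mset_le_add_right[of M' N' N]
  by (simp add: add.commute)

lemma mset_le_union: "M \<preceq> M + N"
proof (induction N)
  case (add a N)
  then show ?case
    using pair_le_trans[OF _ pair_le_add_neg] by (simp add: mset_le_def mset_val_add)
qed simp

lemma mset_val_neg: "mset_val (add_mset a (add_mset (\<^bold>\<not> a) M)) = (Suc (fst (mset_val M)), snd (mset_val M))"
  unfolding mset_val_add
  by (subst add_neg_commute) (rule add_neg_cancel[OF mset_val_notin rep_mset_val])

lemma mset_le_cancel: "M + K \<preceq> N + K \<Longrightarrow> M \<preceq> N"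
proof (induction K)
  case (add a K)
  \<comment> \<open>In place of subtracting a, its complement is added: a and \<not> a together
    raise both counters by one and leave the remainders alone.\<close>
  have "add_mset (\<^bold>\<not> a) (M + add_mset a K) \<preceq> add_mset (\<^bold>\<not> a) (N + add_mset a K)"
    using mset_le_add_right[OF add.prems, of "{#\<^bold>\<not> a#}"] by simp
  then have "M + K \<preceq> N + K"
    by (simp add: add_mset_commute[of "\<^bold>\<not> a" a] mset_le_def mset_val_neg pair_le_def)
  then show ?case by (rule add.IH)
qed simp

lemma neg_le_bot_iff: "\<^bold>\<not> a \<sqsubseteq> \<^bold>\<bottom> \<longleftrightarrow> a \<in> T"
proof
  assume "\<^bold>\<not> a \<sqsubseteq> \<^bold>\<bottom>"
  then have "\<^bold>\<not> \<^bold>\<bottom> \<sqsubseteq> a" by (rule neg_antimono2)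
  moreover have "\<^bold>\<not> \<^bold>\<bottom> \<in> T" using le_mp[OF _ neg_antimono1[OF bot_le]] le_refl le_def by blast
  ultimately show "a \<in> T" using le_mp by blast
qed (rule neg_antimono2, erule weaken)

lemma top_in: "\<^bold>\<top> \<in> T"
  unfolding Top_def using neg_le_bot_iff neg_neg_le by blast

text \<open>A formula in T has the value of the unit, which as a pair is 1 + \<bottom> because
  remainders stay outside T.\<close>

lemma mset_val_single: "mset_val {#a#} = (if a \<in> T then (1, rep \<^bold>\<bottom>) else (0, rep a))"
proof -
  have "rep (\<^bold>\<not> (\<^bold>\<bottom> \<^bold>\<rightarrow> \<^bold>\<not> a)) = rep \<^bold>\<bottom>"
    by (intro rep_cong neg_imp_le bot_le)
  moreover have "rep (\<^bold>\<not> a \<^bold>\<rightarrow> \<^bold>\<bottom>) = rep a"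
  proof (rule rep_cong)
    have "\<^bold>\<not> a \<^bold>\<rightarrow> \<^bold>\<bottom> \<sqsubseteq> \<^bold>\<not> \<^bold>\<bottom> \<^bold>\<rightarrow> a" by (rule contrapos2)
    also have "\<dots> \<sqsubseteq> a" using top_in unfolding Top_def by (rule imp_elim)
    finally show "\<^bold>\<not> a \<^bold>\<rightarrow> \<^bold>\<bottom> \<sqsubseteq> a" .
    show "a \<sqsubseteq> \<^bold>\<not> a \<^bold>\<rightarrow> \<^bold>\<bottom>" by (rule exchange[OF neg_le_imp])
  qed
  ultimately show ?thesis
    by (simp add: mset_val_add mset_val_empty add_neg_def consistent neg_le_bot_iff)
qed

lemma empty_mset_le: "{#} \<preceq> M"
  using mset_le_union[of "{#}" M] by simp

lemma single_mset_le_top: "{#a#} \<preceq> {#\<^bold>\<top>#}"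
  by (simp add: mset_le_def mset_val_single pair_le_def top_in)

lemma top_mset_le: "a \<in> T \<Longrightarrow> {#\<^bold>\<top>#} \<preceq> {#a#}"
  by (simp add: mset_le_def mset_val_single pair_le_def top_in)

lemma neg_mset_le: "{#a, \<^bold>\<not> a#} \<preceq> {#\<^bold>\<top>#}" "{#\<^bold>\<top>#} \<preceq> {#a, \<^bold>\<not> a#}"
  using mset_val_neg[of a "{#}"]
  by (simp_all add: mset_le_def mset_val_single top_in mset_val_empty)

lemma bot_mset_le: "{#\<^bold>\<bottom>#} \<preceq> {#}"
  by (simp add: mset_le_def mset_val_single mset_val_empty pair_le_def consistent)

lemma plus_in_iff: "a \<^bold>\<oplus> b \<in> T \<longleftrightarrow> \<^bold>\<not> a \<sqsubseteq> b"
  using le_mp[OF _ plus_le] le_mp[OF _ le_plus] unfolding le_def[of "\<^bold>\<not> a" b] by blast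

lemma top_mset_le_plus:
  assumes "a \<^bold>\<oplus> b \<in> T"
  shows "{#\<^bold>\<top>#} \<preceq> {#a, b#}"
proof (cases "b \<in> T")
  case True
  then show ?thesis
    using mset_le_trans[OF top_mset_le mset_le_union[of "{#b#}" "{#a#}"]]
    by (simp add: add_mset_commute)
next
  case False
  then show ?thesis
    using assms
    by (simp add: mset_le_def mset_val_add[of a] mset_val_single top_in add_neg_def
        plus_in_iff pair_le_def bot_le)
qed

lemma plus_mset_val:
  assumes "a \<^bold>\<oplus> b \<notin> T"
  shows "mset_val {#a, b#} = mset_val {#a \<^bold>\<oplus> b#}"
proof -
  have "b \<notin> T" using assms weaken[of b] by (auto simp: plus_in_iff)
  moreover have "rep (\<^bold>\<not> a \<^bold>\<rightarrow> b) = rep (a \<^bold>\<oplus> b)" by (intro rep_cong plus_le le_plus)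
  ultimately show ?thesis
    using assms by (simp add: mset_val_add[of a] mset_val_single add_neg_def plus_in_iff)
qed

lemma neg_replicate_not_le:
  assumes "a \<notin> T" "k > 0"
  shows "\<not> replicate_mset k (\<^bold>\<not> a) \<preceq> {#}"
proof
  assume "replicate_mset k (\<^bold>\<not> a) \<preceq> {#}"
  moreover have "{#\<^bold>\<not> a#} \<preceq> replicate_mset k (\<^bold>\<not> a)"
    using mset_le_union[of "{#\<^bold>\<not> a#}" "replicate_mset (k - 1) (\<^bold>\<not> a)"] assms(2)
    by (cases k) auto
  ultimately have "{#\<^bold>\<not> a#} \<preceq> {#}" by (rule mset_le_trans[rotated])
  then have "\<^bold>\<not> a \<sqsubseteq> \<^bold>\<bottom>"
    by (simp add: mset_le_def mset_val_single mset_val_empty pair_le_def split: if_splits)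
  then show False using assms(1) neg_le_bot_iff by blast
qed

end

section \<open>Fourier--Motzkin elimination\<close>

text \<open>Closure under addition alone gives positive integer combinations. They preserve validity
  in every ordered abelian group, so what elimination produces over the reals can be read in Chang's
  group too.\<close>

inductive_set int_cone :: "('v \<Rightarrow> int) set \<Rightarrow> ('v \<Rightarrow> int) set" for S where
  base: "l \<in> S \<Longrightarrow> l \<in> int_cone S"
| add: "l \<in> int_cone S \<Longrightarrow> m \<in> int_cone S \<Longrightarrow> (\<lambda>i. l i + m i) \<in> int_cone S"

lemma int_cone_scale:
  assumes "l \<in> int_cone S" "k > 0"
  shows "(\<lambda>i. k * l i) \<in> int_cone S"
  using assms(2)
proof (induction k rule: int_gr_induct)
  case (step k)
  then show ?case using int_cone.add[OF step.IH assms(1)] by (simp add: algebra_simps)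
qed (use assms in simp)

lemma int_cone_trans: "S \<subseteq> int_cone R \<Longrightarrow> int_cone S \<subseteq> int_cone R"
proof
  fix l assume "S \<subseteq> int_cone R" "l \<in> int_cone S"
  from this(2,1) show "l \<in> int_cone R" by (induction rule: int_cone.induct) (auto intro: int_cone.add)
qed

lemma int_cone_zero: "l \<in> int_cone S \<Longrightarrow> (\<And>l. l \<in> S \<Longrightarrow> l i = 0) \<Longrightarrow> l i = 0"
  by (induction rule: int_cone.induct) auto

definition form_val :: "'v set \<Rightarrow> ('v \<Rightarrow> int) \<Rightarrow> ('v \<Rightarrow> real) \<Rightarrow> real"
  where "form_val V l x = (\<Sum>i\<in>V. real_of_int (l i) * x i)"

lemma int_cone_form_val_nonneg:
  "l \<in> int_cone S \<Longrightarrow> (\<And>l. l \<in> S \<Longrightarrow> 0 \<le> form_val V l x) \<Longrightarrow> 0 \<le> form_val V l x"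
  by (induction rule: int_cone.induct) (auto simp: form_val_def sum.distrib distrib_right)

lemma finite_separation:
  fixes L U :: "real set"
  assumes "finite L" "finite U" "\<And>l u. l \<in> L \<Longrightarrow> u \<in> U \<Longrightarrow> l \<le> u"
  shows "\<exists>t. (\<forall>l\<in>L. l \<le> t) \<and> (\<forall>u\<in>U. t \<le> u)"
proof (cases "L = {}")
  case True
  then show ?thesis using assms(2) by (intro exI[of _ "if U = {} then 0 else Min U"]) auto
next
  case False
  then show ?thesis using assms by (intro exI[of _ "Max L"]) (auto intro: Max.boundedI)
qed

lemma eliminate_variable:
  assumes "finite S" "finite V" "i \<in> V"
  shows "\<exists>S'. finite S' \<and> S' \<subseteq> int_cone S \<and> (\<forall>l\<in>S'. l i = 0) \<and>
    (\<forall>x. (\<forall>l\<in>S'. 0 \<le> form_val V l x) \<longrightarrow> (\<exists>t. \<forall>l\<in>S. 0 \<le> form_val V l (x(i := t))))"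
proof -
  \<comment> \<open>The combination of p and n in which the coefficient of i cancels; the weights -
    n i and p i are positive for p in \<open>?P\<close> and n in \<open>?N\<close>.\<close>
  define comb :: "('a \<Rightarrow> int) \<times> ('a \<Rightarrow> int) \<Rightarrow> 'a \<Rightarrow> int"
    where "comb = (\<lambda>(p, n) j. (- n i) * p j + p i * n j)"
  let ?P = "{l \<in> S. l i > 0}" and ?N = "{l \<in> S. l i < 0}" and ?Z = "{l \<in> S. l i = 0}"
  define S' where "S' = ?Z \<union> comb ` (?P \<times> ?N)"
  show ?thesis
  proof (intro exI[of _ S'] conjI allI impI)
    show "finite S'" using assms(1) by (auto simp: S'_def)
    have "comb (p, n) \<in> int_cone S" if "p \<in> ?P" "n \<in> ?N" for p n
      using that unfolding comb_def prod.case by (intro int_cone.add int_cone_scale int_cone.base) auto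
    then show "S' \<subseteq> int_cone S" by (auto simp: S'_def intro: int_cone.base)
    show "\<forall>l\<in>S'. l i = 0" by (auto simp: S'_def comb_def)
    fix x assume x: "\<forall>l\<in>S'. 0 \<le> form_val V l x"
    define r where "r l = form_val (V - {i}) l x" for l
    have split: "form_val V l y = l i * y i + form_val (V - {i}) l y" for l y
      using assms(2,3) by (simp add: form_val_def sum.remove[of V i])
    have "form_val (V - {i}) l (x(i := t)) = r l" for l t
      unfolding r_def form_val_def by (rule sum.cong) auto
    then have val: "form_val V l (x(i := t)) = l i * t + r l" for l t
      by (simp add: split)
    \<comment> \<open>Forms in \<open>?P\<close> bound the value at i from below, forms in
      \<open>?N\<close> from above. Nonnegativity of \<open>comb (p, n)\<close> says that the two
      bounds are compatible.\<close>
    have "- r p / p i \<le> - r n / n i" if "p \<in> ?P" "n \<in> ?N" for p n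
    proof -
      have "0 \<le> form_val V (comb (p, n)) x" using that by (intro x[rule_format]) (auto simp: S'_def)
      also have "\<dots> = (- n i) * form_val V p x + p i * form_val V n x"
        by (simp add: form_val_def comb_def sum_distrib_left algebra_simps sum.distrib sum_subtractf sum_negf)
      also have "\<dots> = (- n i) * r p + p i * r n"
        by (simp add: split r_def algebra_simps)
      finally show ?thesis using that by (simp add: field_simps)
    qed
    then have "\<exists>t. (\<forall>l\<in>(\<lambda>p. - r p / p i) ` ?P. l \<le> t) \<and> (\<forall>u\<in>(\<lambda>n. - r n / n i) ` ?N. t \<le> u)"
      using assms(1) by (intro finite_separation) auto
    then obtain t where t: "\<And>p. p \<in> ?P \<Longrightarrow> - r p / p i \<le> t" "\<And>n. n \<in> ?N \<Longrightarrow> t \<le> - r n / n i"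
      by blast
    have "0 \<le> form_val V l (x(i := t))" if "l \<in> S" for l
    proof -
      consider "l i = 0" | "l i > 0" | "l i < 0" by linarith
      then show ?thesis
      proof cases
        case 1
        then have "0 \<le> form_val V l x" using that by (intro x[rule_format]) (simp add: S'_def)
        with 1 show ?thesis by (simp add: val) (simp add: split r_def)
      next
        case 2
        then show ?thesis using t(1)[of l] that by (simp add: val field_simps)
      next
        case 3
        then show ?thesis using t(2)[of l] that by (simp add: val field_simps)
      qed
    qed
    then show "\<exists>t. \<forall>l\<in>S. 0 \<le> form_val V l (x(i := t))" by blast
  qed
qed

lemma fourier_motzkin:
  assumes "finite W" "finite S" "finite V" "W \<subseteq> V"
  shows "\<exists>S'. finite S' \<and> S' \<subseteq> int_cone S \<and> (\<forall>l\<in>S'. \<forall>i\<in>W. l i = 0) \<and>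
    (\<forall>y. (\<forall>l\<in>S'. 0 \<le> form_val V l y) \<longrightarrow>
      (\<exists>x. (\<forall>i. i \<notin> W \<longrightarrow> x i = y i) \<and> (\<forall>l\<in>S. 0 \<le> form_val V l x)))"
  using assms(1,4)
proof (induction W rule: finite_induct)
  case empty
  show ?case by (rule exI[of _ S]) (use assms(2) in \<open>auto intro: int_cone.base\<close>)
next
  case (insert i W)
  then obtain S1 where S1: "finite S1" "S1 \<subseteq> int_cone S" "\<forall>l\<in>S1. \<forall>i\<in>W. l i = 0"
    "\<forall>y. (\<forall>l\<in>S1. 0 \<le> form_val V l y) \<longrightarrow>
      (\<exists>x. (\<forall>i. i \<notin> W \<longrightarrow> x i = y i) \<and> (\<forall>l\<in>S. 0 \<le> form_val V l x))"
    by auto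
  have "i \<in> V" using insert.prems by simp
  obtain S2 where S2: "finite S2" "S2 \<subseteq> int_cone S1" "\<forall>l\<in>S2. l i = 0"
    "\<forall>x. (\<forall>l\<in>S2. 0 \<le> form_val V l x) \<longrightarrow> (\<exists>t. \<forall>l\<in>S1. 0 \<le> form_val V l (x(i := t)))"
    using eliminate_variable[OF S1(1) assms(3) \<open>i \<in> V\<close>] by blast
  show ?case
  proof (intro exI[of _ S2] conjI ballI allI impI)
    show "finite S2" by (rule S2(1))
    show "S2 \<subseteq> int_cone S" using S2(2) int_cone_trans[OF S1(2)] by (rule subset_trans)
    \<comment> \<open>Coefficients that vanish throughout \<open>S1\<close> vanish in sums of its
      members, so eliminating i does not bring back variables of W.\<close>
    show "l j = 0" if "l \<in> S2" "j \<in> insert i W" for l j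
      using that S2(2,3) S1(3) int_cone_zero[of l S1 j] by auto
    fix y assume "\<forall>l\<in>S2. 0 \<le> form_val V l y"
    then obtain t where "\<forall>l\<in>S1. 0 \<le> form_val V l (y(i := t))" using S2(4) by auto
    then obtain x where "\<forall>j. j \<notin> W \<longrightarrow> x j = (y(i := t)) j" "\<forall>l\<in>S. 0 \<le> form_val V l x"
      using S1(4)[rule_format, of "y(i := t)"] by auto
    then show "\<exists>x. (\<forall>j. j \<notin> insert i W \<longrightarrow> x j = y j) \<and> (\<forall>l\<in>S. 0 \<le> form_val V l x)"
      by (intro exI[of _ x]) auto
  qed
qed

text \<open>A pair \<open>(M, N)\<close> of multisets of variables is read as the inequality \<open>\<Sum>M \<le> \<Sum>N\<close>.\<close>

definition ineq_holds :: "('v \<Rightarrow> real) \<Rightarrow> 'v multiset \<times> 'v multiset \<Rightarrow> bool"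
  where "ineq_holds x = (\<lambda>(M, N). (\<Sum>i\<in>#M. x i) \<le> (\<Sum>i\<in>#N. x i))"

definition ineq_form :: "'v multiset \<times> 'v multiset \<Rightarrow> 'v \<Rightarrow> int"
  where "ineq_form = (\<lambda>(M, N) i. int (count N i) - int (count M i))"

definition ineq_vars :: "'v multiset \<times> 'v multiset \<Rightarrow> 'v set"
  where "ineq_vars = (\<lambda>(M, N). set_mset M \<union> set_mset N)"

lemma sum_count_mult:
  fixes x :: "'v \<Rightarrow> real"
  assumes "finite V" "set_mset M \<subseteq> V"
  shows "(\<Sum>i\<in>V. real (count M i) * x i) = (\<Sum>i\<in>#M. x i)"
  using assms(2)
proof (induction M)
  case (add a M)
  have "(\<Sum>i\<in>V. real (count (add_mset a M) i) * x i)
      = (\<Sum>i\<in>V. real (count M i) * x i + (if i = a then x i else 0))"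
    by (rule sum.cong) (auto simp: algebra_simps)
  also have "\<dots> = x a + (\<Sum>i\<in>#M. x i)" using add assms(1) by (simp add: sum.distrib)
  finally show ?case by simp
qed simp

lemma form_val_ineq:
  assumes "finite V" "ineq_vars c \<subseteq> V"
  shows "0 \<le> form_val V (ineq_form c) x \<longleftrightarrow> ineq_holds x c"
proof -
  obtain M N where c: "c = (M, N)" by fastforce
  have "form_val V (ineq_form c) x = (\<Sum>i\<in>#N. x i) - (\<Sum>i\<in>#M. x i)"
    using assms sum_count_mult[of V M x] sum_count_mult[of V N x]
    by (simp add: c form_val_def ineq_form_def ineq_vars_def left_diff_distrib sum_subtractf)
  then show ?thesis by (simp add: c ineq_holds_def)
qed

lemma ineq_form_zero: "i \<notin> ineq_vars c \<Longrightarrow> ineq_form c i = 0"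
  by (auto simp: ineq_vars_def ineq_form_def not_in_iff split: prod.splits)

section \<open>Finite strong completeness of \L{}ukasiewicz logic\<close>

abbreviation luk_val :: "('a \<Rightarrow> real) \<Rightarrow> 'a form \<Rightarrow> real"
  where "luk_val \<equiv> mv_eval unit_MV"

lemma luk_val_simps [simp]:
  "luk_val v \<^bold>\<bottom> = 0"
  "luk_val v (\<^bold>\<not> \<phi>) = 1 - luk_val v \<phi>"
  "luk_val v (\<phi> \<^bold>\<oplus> \<psi>) = min 1 (luk_val v \<phi> + luk_val v \<psi>)"
  "luk_val v \<^bold>\<top> = 1"
  "luk_val v (\<phi> \<^bold>\<rightarrow> \<psi>) = min 1 (1 - luk_val v \<phi> + luk_val v \<psi>)"
  by (auto simp: unit_MV_def Top_def Imp_def)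

declare mv_eval.simps(2-4) [simp del]

lemma luk_val_range:
  assumes "\<And>p. v p \<in> {0..1}"
  shows "0 \<le> luk_val v \<phi>" "luk_val v \<phi> \<le> 1"
  by (induction \<phi>) (use assms in auto)

lemma luk_val_imp_eq_1: "luk_val v (\<phi> \<^bold>\<rightarrow> \<psi>) = 1 \<longleftrightarrow> luk_val v \<phi> \<le> luk_val v \<psi>"
  by (auto simp: min_def)

context
  fixes v :: "'a \<Rightarrow> real"
  assumes v: "\<And>p. v p \<in> {0..1}"
begin

lemma luk_val_Times: "luk_val v (\<phi> \<^bold>\<odot> \<psi>) = max 0 (luk_val v \<phi> + luk_val v \<psi> - 1)"
  unfolding Times_def by (simp add: min_def max_def)

lemma luk_val_Or: "luk_val v (\<phi> \<^bold>\<or> \<psi>) = max (luk_val v \<phi>) (luk_val v \<psi>)"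
  using luk_val_range[of v \<phi>, OF v] luk_val_range[of v \<psi>, OF v]
  by (simp add: Or_def min_def max_def)

lemma luk_val_And: "luk_val v (\<phi> \<^bold>\<and> \<psi>) = min (luk_val v \<phi>) (luk_val v \<psi>)"
  by (simp add: And_def luk_val_Or max_def min_def)

lemma luk_val_Iff: "luk_val v (\<phi> \<^bold>\<leftrightarrow> \<psi>) = 1 \<longleftrightarrow> luk_val v \<phi> = luk_val v \<psi>"
  unfolding Iff_def luk_val_And by (auto simp: min_def)

lemma luk_axiom_valid:
  assumes "luk_axiom \<phi>"
  shows "luk_val v \<phi> = 1"
  using assms
proof cases
  case (A1 \<phi> \<psi>)
  show ?thesis
    unfolding A1 luk_val_imp_eq_1 using luk_val_range[of v _, OF v] by simp
next
  case (A2 \<phi> \<psi> \<gamma>)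
  show ?thesis unfolding A2 luk_val_imp_eq_1 by (auto simp: min_def)
next
  case (A3 \<phi> \<psi>)
  show ?thesis
    unfolding A3 Or_def[symmetric] luk_val_imp_eq_1 luk_val_Or by (simp add: max.commute)
next
  case (A4 \<phi> \<psi>)
  show ?thesis unfolding A4 luk_val_imp_eq_1 by simp
next
  case (Bot \<phi>)
  show ?thesis unfolding Bot luk_val_imp_eq_1 using luk_val_range[of v \<phi>, OF v] by simp
next
  case (Plus1 \<phi> \<psi>)
  show ?thesis unfolding Plus1 luk_val_imp_eq_1 by simp
next
  case (Plus2 \<phi> \<psi>)
  show ?thesis unfolding Plus2 luk_val_imp_eq_1 by simp
qed

end

lemma luk_thm_valid:
  assumes "\<turnstile>\<^sub>L \<phi>" "\<And>p. v p \<in> {0..1}"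
  shows "luk_val v \<phi> = 1"
  using assms(1)
proof induction
  case (mp \<phi> \<psi>)
  then show ?case using luk_val_range[of v \<psi>, OF assms(2)] by (auto simp: min_def)
qed (rule luk_axiom_valid[OF assms(2)])

section \<open>Truth conditions as homogeneous linear inequalities, and completeness\<close>

primrec subforms :: "'a form \<Rightarrow> 'a form set" where
  "subforms (Atom p) = {Atom p}"
| "subforms \<^bold>\<bottom> = {\<^bold>\<bottom>}"
| "subforms (\<^bold>\<not> \<phi>) = insert (\<^bold>\<not> \<phi>) (subforms \<phi>)"
| "subforms (\<phi> \<^bold>\<oplus> \<psi>) = insert (\<phi> \<^bold>\<oplus> \<psi>) (subforms \<phi> \<union> subforms \<psi>)"

definition sub_closed :: "'a form set \<Rightarrow> bool" where
  "sub_closed F \<longleftrightarrow> (\<forall>\<phi>. \<^bold>\<not> \<phi> \<in> F \<longrightarrow> \<phi> \<in> F) \<and> (\<forall>\<phi> \<psi>. \<phi> \<^bold>\<oplus> \<psi> \<in> F \<longrightarrow> \<phi> \<in> F \<and> \<psi> \<in> F)"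

lemma sub_closed_Neg: "sub_closed F \<Longrightarrow> \<^bold>\<not> \<phi> \<in> F \<Longrightarrow> \<phi> \<in> F"
  and sub_closed_Plus: "sub_closed F \<Longrightarrow> \<phi> \<^bold>\<oplus> \<psi> \<in> F \<Longrightarrow> \<phi> \<in> F \<and> \<psi> \<in> F"
  unfolding sub_closed_def by blast+

lemma finite_subforms: "finite (subforms \<phi>)"
  by (induction \<phi>) auto

lemma self_in_subforms: "\<phi> \<in> subforms \<phi>"
  by (cases \<phi>) auto

lemma sub_closed_subforms: "sub_closed (subforms \<phi>)"
proof -
  have "\<alpha> \<in> subforms \<phi>" if "\<^bold>\<not> \<alpha> \<in> subforms \<phi>" for \<alpha>
    using that by (induction \<phi>) (auto simp: self_in_subforms)
  moreover have "\<alpha> \<in> subforms \<phi> \<and> \<beta> \<in> subforms \<phi>" if "\<alpha> \<^bold>\<oplus> \<beta> \<in> subforms \<phi>" for \<alpha> \<beta>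
    using that by (induction \<phi>) (auto simp: self_in_subforms)
  ultimately show ?thesis unfolding sub_closed_def by blast
qed

lemma sub_closed_UN: "(\<And>\<phi>. \<phi> \<in> I \<Longrightarrow> sub_closed (A \<phi>)) \<Longrightarrow> sub_closed (\<Union>\<phi>\<in>I. A \<phi>)"
  unfolding sub_closed_def by blast

text \<open>
  The value of each formula is a variable, with \<open>\<top>\<close> for the unit.  The set \<open>\<sigma>\<close> prescribes which
  sums are truncated; for a fixed \<open>\<sigma>\<close> the truth conditions become homogeneous linear.
\<close>

fun branch_ineqs :: "'a form set \<Rightarrow> 'a form \<Rightarrow> ('a form multiset \<times> 'a form multiset) set" where
  "branch_ineqs \<sigma> (Atom p) = {}"
| "branch_ineqs \<sigma> \<^bold>\<bottom> = {({#\<^bold>\<bottom>#}, {#})}"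
| "branch_ineqs \<sigma> (\<^bold>\<not> \<phi>) = {({#\<phi>, \<^bold>\<not> \<phi>#}, {#\<^bold>\<top>#}), ({#\<^bold>\<top>#}, {#\<phi>, \<^bold>\<not> \<phi>#})}"
| "branch_ineqs \<sigma> (\<phi> \<^bold>\<oplus> \<psi>) =
    (if \<phi> \<^bold>\<oplus> \<psi> \<in> \<sigma> then {({#\<^bold>\<top>#}, {#\<phi> \<^bold>\<oplus> \<psi>#}), ({#\<^bold>\<top>#}, {#\<phi>, \<psi>#})}
     else {({#\<phi>, \<psi>#}, {#\<phi> \<^bold>\<oplus> \<psi>#}), ({#\<phi> \<^bold>\<oplus> \<psi>#}, {#\<phi>, \<psi>#})})"

definition val_ineqs :: "'a form set \<Rightarrow> 'a form set \<Rightarrow> ('a form multiset \<times> 'a form multiset) set"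
  where "val_ineqs F \<sigma> =
    (\<Union>\<phi>\<in>F. {({#}, {#\<phi>#}), ({#\<phi>#}, {#\<^bold>\<top>#})} \<union> branch_ineqs \<sigma> \<phi>)"

lemma finite_val_ineqs: "finite F \<Longrightarrow> finite (val_ineqs F \<sigma>)"
proof -
  have "finite (branch_ineqs \<sigma> \<phi>)" for \<phi> by (cases \<phi>) auto
  then show "finite F \<Longrightarrow> finite (val_ineqs F \<sigma>)" by (auto simp: val_ineqs_def)
qed

lemma val_ineqs_vars:
  assumes "sub_closed F" "\<^bold>\<top> \<in> F" "c \<in> val_ineqs F \<sigma>"
  shows "ineq_vars c \<subseteq> F"
proof -
  have "ineq_vars c \<subseteq> F" if "c \<in> branch_ineqs \<sigma> \<phi>" "\<phi> \<in> F" for \<phi>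
    using that assms(1,2)
    by (cases \<phi>) (auto simp: ineq_vars_def split: if_splits dest: sub_closed_Neg sub_closed_Plus)
  then show ?thesis using assms(2,3) by (auto simp: val_ineqs_def ineq_vars_def)
qed

lemma val_ineqs_luk_val:
  assumes "\<And>p. v p \<in> {0..1}" "\<And>\<phi>. \<phi> \<in> F \<Longrightarrow> \<phi> \<in> \<sigma> \<longleftrightarrow> luk_val v \<phi> = 1"
    and c: "c \<in> val_ineqs F \<sigma>"
  shows "ineq_holds (luk_val v) c"
proof -
  have "ineq_holds (luk_val v) c" if "c \<in> branch_ineqs \<sigma> \<phi>" "\<phi> \<in> F" for \<phi>
    using that(1) assms(2)[OF that(2)]
    by (cases \<phi>) (auto simp: ineq_holds_def min_def split: if_splits)
  then show ?thesis
    using c luk_val_range[of v, OF assms(1)] by (auto simp: val_ineqs_def ineq_holds_def)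
qed

text \<open>The system is homogeneous, so its solutions are valuations scaled by the value of
  \<top>: divide by it. If that value is 0, the bounds make x vanish on F and any valuation will do;
  the default 0 in v covers this case and the atoms outside F.\<close>

lemma val_ineqs_solution:
  fixes x :: "'a form \<Rightarrow> real"
  assumes F: "sub_closed F" "\<^bold>\<top> \<in> F"
    and x: "\<And>c. c \<in> val_ineqs F \<sigma> \<Longrightarrow> ineq_holds x c"
  obtains v where "\<And>p. v p \<in> {0..1}" "\<And>\<phi>. \<phi> \<in> F \<Longrightarrow> x \<phi> = x \<^bold>\<top> * luk_val v \<phi>"
proof -
  define u where "u = x \<^bold>\<top>"
  have bnd: "0 \<le> x \<phi>" "x \<phi> \<le> u" if "\<phi> \<in> F" for \<phi>
    using x[of "({#}, {#\<phi>#})"] x[of "({#\<phi>#}, {#\<^bold>\<top>#})"] that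
    by (auto simp: val_ineqs_def ineq_holds_def u_def)
  define v where "v p = (if Atom p \<in> F \<and> u > 0 then x (Atom p) / u else 0)" for p
  have v: "v p \<in> {0..1}" for p using bnd[of "Atom p"] by (auto simp: v_def)
  have br: "ineq_holds x c" if "c \<in> branch_ineqs \<sigma> \<phi>" "\<phi> \<in> F" for c \<phi>
    using that by (intro x) (auto simp: val_ineqs_def)
  have "x \<phi> = u * luk_val v \<phi>" if "\<phi> \<in> F" for \<phi>
  proof (cases "u > 0")
    case False
    then have "u = 0" using bnd[OF F(2)] by (simp add: u_def)
    then show ?thesis using bnd[OF that] by simp
  next
    case True
    from that show ?thesis
    proof (induction \<phi>)
      case (Atom p)
      then show ?case using True by (simp add: v_def)
    next
      case Bot
      then show ?case using bnd[OF Bot] br[OF _ Bot] by (simp add: ineq_holds_def)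
    next
      case (Neg \<phi>)
      then have "\<phi> \<in> F" using F(1) unfolding sub_closed_def by blast
      then have "x \<phi> = u * luk_val v \<phi>" by (rule Neg.IH)
      moreover have "x \<phi> + x (\<^bold>\<not> \<phi>) = u"
        using br[OF _ Neg.prems, of "({#\<phi>, \<^bold>\<not> \<phi>#}, {#\<^bold>\<top>#})"]
          br[OF _ Neg.prems, of "({#\<^bold>\<top>#}, {#\<phi>, \<^bold>\<not> \<phi>#})"]
        by (simp add: ineq_holds_def u_def)
      ultimately show ?case by (simp add: algebra_simps)
    next
      case (Plus \<phi> \<psi>)
      then have "\<phi> \<in> F" "\<psi> \<in> F" using F(1) unfolding sub_closed_def by blast+
      then have IH: "x \<phi> = u * luk_val v \<phi>" "x \<psi> = u * luk_val v \<psi>"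
        using Plus.IH by auto
      show ?case
      proof (cases "\<phi> \<^bold>\<oplus> \<psi> \<in> \<sigma>")
        case \<sigma>: True
        then have "x (\<phi> \<^bold>\<oplus> \<psi>) = u" "u * 1 \<le> u * (luk_val v \<phi> + luk_val v \<psi>)"
          using br[OF _ Plus.prems, of "({#\<^bold>\<top>#}, {#\<phi> \<^bold>\<oplus> \<psi>#})"]
            br[OF _ Plus.prems, of "({#\<^bold>\<top>#}, {#\<phi>, \<psi>#})"] bnd[OF Plus.prems] IH
          by (auto simp: ineq_holds_def u_def[symmetric] algebra_simps)
        then show ?thesis using True by (simp add: min_def)
      next
        case \<sigma>: False
        then have "x (\<phi> \<^bold>\<oplus> \<psi>) = u * (luk_val v \<phi> + luk_val v \<psi>)"
          using br[OF _ Plus.prems, of "({#\<phi>, \<psi>#}, {#\<phi> \<^bold>\<oplus> \<psi>#})"]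
            br[OF _ Plus.prems, of "({#\<phi> \<^bold>\<oplus> \<psi>#}, {#\<phi>, \<psi>#})"] IH
          by (auto simp: ineq_holds_def algebra_simps)
        moreover from this have "luk_val v \<phi> + luk_val v \<psi> \<le> 1"
          using bnd(2)[OF Plus.prems] True by (simp add: mult_le_cancel_left1)
        ultimately show ?thesis by simp
      qed
    qed
  qed
  then show ?thesis using that[of v] v unfolding u_def by blast
qed

text \<open>The prime theory selects its own branch: a sum is truncated exactly when its
  \<oplus>-formula belongs to T.\<close>

lemma (in prime_theory) val_ineqs_mset_le:
  assumes "(M, N) \<in> val_ineqs F T"
  shows "M \<preceq> N"
proof -
  have "M \<preceq> N" if "(M, N) \<in> branch_ineqs T \<phi>" for \<phi>
  proof (cases \<phi>)
    case (Plus \<alpha> \<beta>)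
    then show ?thesis
      using that top_mset_le top_mset_le_plus plus_mset_val[of \<alpha> \<beta>]
      by (auto simp: mset_le_def split: if_splits)
  qed (use that bot_mset_le neg_mset_le in auto)
  then show ?thesis
    using assms empty_mset_le single_mset_le_top by (auto simp: val_ineqs_def)
qed

theorem finite_strong_completeness:
  fixes \<Gamma> :: "'a form set"
  assumes "finite \<Gamma>"
    and valid: "\<And>v. (\<And>p. v p \<in> {0..1}) \<Longrightarrow> (\<And>\<gamma>. \<gamma> \<in> \<Gamma> \<Longrightarrow> luk_val v \<gamma> = 1) \<Longrightarrow> luk_val v \<phi> = 1"
  shows "luk_deriv \<Gamma> \<phi>"
proof (rule ccontr)
  assume "\<not> luk_deriv \<Gamma> \<phi>"
  then obtain T where "prime_theory T" "\<Gamma> \<subseteq> T" "\<phi> \<notin> T" by (rule prime_theory_exists)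
  then interpret prime_theory T by simp
  define F where "F = (\<Union>\<psi>\<in>\<Gamma> \<union> {\<^bold>\<not> \<phi>, \<^bold>\<top>}. subforms \<psi>)"
  have "finite F" using assms(1) by (simp add: F_def finite_subforms)
  moreover have "sub_closed F"
    unfolding F_def by (rule sub_closed_UN) (rule sub_closed_subforms)
  ultimately have F: "finite F" "sub_closed F" by auto
  have in_F: "\<Gamma> \<subseteq> F" "\<^bold>\<not> \<phi> \<in> F" "\<^bold>\<top> \<in> F"
    using self_in_subforms unfolding F_def by blast+
  define K where "K = val_ineqs F T \<union> (\<lambda>\<gamma>. ({#\<^bold>\<top>#}, {#\<gamma>#})) ` \<Gamma>"
  have K: "finite K" using finite_val_ineqs F assms(1) by (simp add: K_def)
  have K_vars: "ineq_vars c \<subseteq> F" if "c \<in> K" for c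
    using that val_ineqs_vars[OF F(2) in_F(3)] in_F by (auto simp: K_def ineq_vars_def)
  have K_le: "mset_le M N" if "(M, N) \<in> K" for M N
    using that val_ineqs_mset_le top_mset_le \<open>\<Gamma> \<subseteq> T\<close> by (auto simp: K_def)
  have int_cone: "\<exists>M N. l = ineq_form (M, N) \<and> mset_le M N" if "l \<in> int_cone (ineq_form ` K)" for l
    using that
  proof induction
    case (base l)
    then show ?case using K_le by fast
  next
    case (add l m)
    then obtain M N M' N' where "l = ineq_form (M, N)" "mset_le M N"
      "m = ineq_form (M', N')" "mset_le M' N'" by blast
    then show ?case using mset_le_add_mono
      by (intro exI[of _ "M + M'"] exI[of _ "N + N'"]) (auto simp: ineq_form_def)
  qed
  obtain S where S: "S \<subseteq> int_cone (ineq_form ` K)" "\<forall>l\<in>S. \<forall>i\<in>F - {\<^bold>\<not> \<phi>}. l i = 0"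
    "\<forall>y. (\<forall>l\<in>S. 0 \<le> form_val F l y) \<longrightarrow>
      (\<exists>x. (\<forall>i. i \<notin> F - {\<^bold>\<not> \<phi>} \<longrightarrow> x i = y i) \<and> (\<forall>l\<in>ineq_form ` K. 0 \<le> form_val F l x))"
    using fourier_motzkin[of "F - {\<^bold>\<not> \<phi>}" "ineq_form ` K" F] F(1) K by auto
  \<comment> \<open>All variables but \<open>\<not>\<phi>\<close> are eliminated; a negative coefficient of \<open>\<not>\<phi>\<close> would make \<open>\<not>\<phi>\<close>
    vanish in Chang's group, that is, put \<open>\<phi>\<close> into \<open>T\<close>.\<close>
  have "0 \<le> form_val F l (\<lambda>_. 1)" if l: "l \<in> S" for l
  proof -
    have zero: "l i = 0" if "i \<noteq> \<^bold>\<not> \<phi>" for i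
    proof (cases "i \<in> F")
      case False
      show ?thesis
        by (rule int_cone_zero[of l "ineq_form ` K"])
           (use S(1) l K_vars False in \<open>auto intro!: ineq_form_zero\<close>)
    qed (use that S(2) l in blast)
    obtain M N where MN: "l = ineq_form (M, N)" "mset_le M N" using int_cone S(1) l by blast
    have "0 \<le> l (\<^bold>\<not> \<phi>)"
    proof (rule ccontr)
      define k where "k = nat (- l (\<^bold>\<not> \<phi>))"
      assume "\<not> ?thesis"
      then have "k > 0" by (simp add: k_def)
      have "M = replicate_mset k (\<^bold>\<not> \<phi>) + N"
      proof (rule multiset_eqI)
        fix i
        have "int (count N i) - int (count M i) = l i" by (simp add: MN ineq_form_def)
        then show "count M i = count (replicate_mset k (\<^bold>\<not> \<phi>) + N) i"
          using zero[of i] \<open>k > 0\<close> by (auto simp: k_def)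
      qed
      then have "mset_le (replicate_mset k (\<^bold>\<not> \<phi>)) {#}"
        using MN(2) mset_le_cancel[of _ N "{#}"] by simp
      then show False using neg_replicate_not_le \<open>\<phi> \<notin> T\<close> \<open>k > 0\<close> by blast
    qed
    moreover have "form_val F l (\<lambda>_. 1) = real_of_int (l (\<^bold>\<not> \<phi>))"
      using F(1) in_F(2) zero by (simp add: form_val_def sum.remove[of F "\<^bold>\<not> \<phi>"])
    ultimately show ?thesis by simp
  qed
  \<comment> \<open>Homogeneity permits the normalisation x(\<not> \<phi>) = 1 in place of x(\<top>)
    = 1. The unit is then at least 1, and after division by it \<not> \<phi> is still positive, so
    \<phi> is refuted.\<close>
  then obtain x where x: "x (\<^bold>\<not> \<phi>) = 1" "\<And>c. c \<in> K \<Longrightarrow> 0 \<le> form_val F (ineq_form c) x"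
    using S(3)[rule_format, of "\<lambda>_. 1"] by auto
  have hold: "ineq_holds x c" if "c \<in> K" for c
    using x(2)[OF that] form_val_ineq[OF F(1) K_vars[OF that]] by simp
  obtain v where v: "\<And>p. v p \<in> {0..1}" "\<And>\<psi>. \<psi> \<in> F \<Longrightarrow> x \<psi> = x \<^bold>\<top> * luk_val v \<psi>"
    by (rule val_ineqs_solution[OF F(2) in_F(3), of T x]) (use hold in \<open>auto simp: K_def\<close>)
  have "1 \<le> x \<^bold>\<top>"
    using hold[of "({#\<^bold>\<not> \<phi>#}, {#\<^bold>\<top>#})"] in_F x(1)
    by (auto simp: K_def val_ineqs_def ineq_holds_def)
  have "luk_val v \<gamma> = 1" if "\<gamma> \<in> \<Gamma>" for \<gamma>
  proof -
    have "x \<^bold>\<top> \<le> x \<gamma>"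
      using hold[of "({#\<^bold>\<top>#}, {#\<gamma>#})"] that by (auto simp: K_def ineq_holds_def)
    then have "1 \<le> luk_val v \<gamma>"
      using v(2)[of \<gamma>] that in_F \<open>1 \<le> x \<^bold>\<top>\<close> by (auto simp: mult_le_cancel_left1)
    then show ?thesis using luk_val_range(2)[of v \<gamma>, OF v(1)] by simp
  qed
  then have "luk_val v \<phi> = 1" using v(1) valid by blast
  then show False using v(2)[OF in_F(2)] x(1) by simp
qed

corollary weak_completeness:
  assumes "\<And>v. (\<And>p. v p \<in> {0..1}) \<Longrightarrow> luk_val v \<phi> = 1"
  shows "\<turnstile>\<^sub>L \<phi>"
  using finite_strong_completeness[of "{}" \<phi>] assms by (simp add: luk_deriv_empty)

section \<open>Additivity of \<open>P\<close>\<close>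

text \<open>\<open>R\<close> follows already from finitely many theorems, as finite strong completeness will require.\<close>

definition fp_entails :: "((event \<Rightarrow> real) \<Rightarrow> bool) \<Rightarrow> bool" where
  "fp_entails R \<longleftrightarrow> (\<exists>G. finite G \<and> (\<forall>\<gamma>\<in>G. {} \<turnstile>\<^sub>F\<^sub>P \<gamma>) \<and>
    (\<forall>v. (\<forall>p. v p \<in> {0..1}) \<longrightarrow> (\<forall>\<gamma>\<in>G. luk_val v \<gamma> = 1) \<longrightarrow> R v))"

lemma fp_entails_mono:
  assumes "fp_entails R" "\<And>v. (\<And>p. v p \<in> {0..1}) \<Longrightarrow> R v \<Longrightarrow> Q v"
  shows "fp_entails Q"
proof -
  obtain G where G: "finite G" "\<forall>\<gamma>\<in>G. {} \<turnstile>\<^sub>F\<^sub>P \<gamma>"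
    "\<forall>v. (\<forall>p. v p \<in> {0..1}) \<longrightarrow> (\<forall>\<gamma>\<in>G. luk_val v \<gamma> = 1) \<longrightarrow> R v"
    using assms(1) unfolding fp_entails_def by metis
  show ?thesis
    unfolding fp_entails_def
    by (rule exI[of _ G], intro conjI G(1,2) allI impI) (rule assms(2), use G(3) in auto)
qed

lemma fp_entails_thm: "{} \<turnstile>\<^sub>F\<^sub>P \<gamma> \<Longrightarrow> fp_entails (\<lambda>v. luk_val v \<gamma> = 1)"
  unfolding fp_entails_def by (intro exI[of _ "{\<gamma>}"]) auto

lemma fp_entails_trivial: "(\<And>v. (\<And>p. v p \<in> {0..1}) \<Longrightarrow> R v) \<Longrightarrow> fp_entails R"
  unfolding fp_entails_def by (intro exI[of _ "{}"]) auto

lemma fp_entails_conj: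
  assumes "fp_entails R" "fp_entails Q"
  shows "fp_entails (\<lambda>v. R v \<and> Q v)"
proof -
  obtain G H where "finite G" "\<forall>\<gamma>\<in>G. {} \<turnstile>\<^sub>F\<^sub>P \<gamma>"
    "\<forall>v. (\<forall>p. v p \<in> {0..1}) \<longrightarrow> (\<forall>\<gamma>\<in>G. luk_val v \<gamma> = 1) \<longrightarrow> R v"
    "finite H" "\<forall>\<gamma>\<in>H. {} \<turnstile>\<^sub>F\<^sub>P \<gamma>"
    "\<forall>v. (\<forall>p. v p \<in> {0..1}) \<longrightarrow> (\<forall>\<gamma>\<in>H. luk_val v \<gamma> = 1) \<longrightarrow> Q v"
    using assms unfolding fp_entails_def by metis
  then show ?thesis
    unfolding fp_entails_def
    by (intro exI[of _ "G \<union> H"] conjI ballI allI impI) (auto simp del: atLeastAtMost_iff)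
qed

lemma fp_entails_ball:
  assumes "finite I" "\<And>i. i \<in> I \<Longrightarrow> fp_entails (R i)"
  shows "fp_entails (\<lambda>v. \<forall>i\<in>I. R i v)"
  using assms
proof (induction I)
  case empty
  show ?case by (rule fp_entails_trivial) simp
next
  case (insert i I)
  then have "fp_entails (\<lambda>v. R i v \<and> (\<forall>i\<in>I. R i v))" by (intro fp_entails_conj) auto
  then show ?case by simp
qed

text \<open>Weak completeness turns validity into provability, as (N) requires.\<close>

lemma fp_valid:
  assumes "\<And>w. (\<And>p. w p \<in> {0..1}) \<Longrightarrow> luk_val w \<phi> = 1"
  shows "fp_entails (\<lambda>v. v \<phi> = 1)"
  using fp_entails_thm[OF FP_deriv.N[OF weak_completeness[OF assms]]] by simp

lemma fp_neg: "fp_entails (\<lambda>v. v (\<^bold>\<not> \<phi>) = 1 - v \<phi>)"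
  by (rule fp_entails_mono[OF fp_entails_thm[OF FP_deriv.P1[of _ \<phi>]]])
     (subst (asm) luk_val_Iff, auto)

lemma fp_imp: "fp_entails (\<lambda>v. v (\<phi> \<^bold>\<rightarrow> \<psi>) \<le> 1 - v \<phi> + v \<psi>)"
  by (rule fp_entails_mono[OF fp_entails_thm[OF FP_deriv.P2[of _ \<phi> \<psi>]]])
     (subst (asm) luk_val_imp_eq_1, simp)

lemma fp_mono:
  assumes "\<And>w. (\<And>p. w p \<in> {0..1}) \<Longrightarrow> luk_val w \<phi> \<le> luk_val w \<psi>"
  shows "fp_entails (\<lambda>v. v \<phi> \<le> v \<psi>)"
proof -
  have "fp_entails (\<lambda>v. v (\<phi> \<^bold>\<rightarrow> \<psi>) = 1)"
    using assms by (intro fp_valid) (simp only: luk_val_imp_eq_1)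
  from fp_entails_conj[OF this fp_imp[of \<phi> \<psi>]] show ?thesis by (rule fp_entails_mono) simp
qed

text \<open>(P3) contains two truncations. The bound v(\<phi> \<odot> \<psi>) \<le> v(\<phi>)
  removes the inner one. The outer one goes because \<psi> entails \<phi> \<rightarrow> \<phi>
  \<odot> \<psi>, whose probability (P2) bounds by 1 - v(\<phi>) + v(\<phi> \<odot> \<psi>).\<close>

lemma fp_plus: "fp_entails (\<lambda>v. v (\<phi> \<^bold>\<oplus> \<psi>) + v (\<phi> \<^bold>\<odot> \<psi>) = v \<phi> + v \<psi>)"
proof -
  have "fp_entails (\<lambda>v. v (\<phi> \<^bold>\<odot> \<psi>) \<le> v \<phi>)"
    by (rule fp_mono) (simp add: luk_val_Times luk_val_range)
  moreover have "fp_entails (\<lambda>v. v \<psi> \<le> v (\<phi> \<^bold>\<rightarrow> \<phi> \<^bold>\<odot> \<psi>))"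
    by (rule fp_mono) (simp add: luk_val_Times luk_val_range)
  moreover have "fp_entails (\<lambda>v. luk_val v (P (\<phi> \<^bold>\<oplus> \<psi>))
      = luk_val v ((P \<phi> \<^bold>\<rightarrow> P (\<phi> \<^bold>\<odot> \<psi>)) \<^bold>\<rightarrow> P \<psi>))"
    by (rule fp_entails_mono[OF fp_entails_thm[OF FP_deriv.P3[of _ \<phi> \<psi>]]])
       (subst (asm) luk_val_Iff, auto)
  ultimately have "fp_entails (\<lambda>v. (v (\<phi> \<^bold>\<odot> \<psi>) \<le> v \<phi> \<and> v \<psi> \<le> v (\<phi> \<^bold>\<rightarrow> \<phi> \<^bold>\<odot> \<psi>)) \<and>
      v (\<phi> \<^bold>\<rightarrow> \<phi> \<^bold>\<odot> \<psi>) \<le> 1 - v \<phi> + v (\<phi> \<^bold>\<odot> \<psi>) \<and>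
      luk_val v (P (\<phi> \<^bold>\<oplus> \<psi>)) = luk_val v ((P \<phi> \<^bold>\<rightarrow> P (\<phi> \<^bold>\<odot> \<psi>)) \<^bold>\<rightarrow> P \<psi>))"
    using fp_imp by (intro fp_entails_conj)
  then show ?thesis by (rule fp_entails_mono) (auto simp: min_def split: if_splits)
qed

text \<open>
  The formulas \<open>layers [\<phi>\<^sub>1, \<dots>, \<phi>\<^sub>k]\<close> take the values \<open>min 1 (max 0 (x - i))\<close> for
  \<open>i = 0, \<dots>, k - 1\<close>, where \<open>x\<close> is the sum of the values of the \<open>\<phi>\<^sub>j\<close>.
\<close>

primrec insert_layer :: "'a form \<Rightarrow> 'a form list \<Rightarrow> 'a form list" where
  "insert_layer \<phi> [] = [\<phi>]"
| "insert_layer \<phi> (\<psi> # L) = (\<phi> \<^bold>\<oplus> \<psi>) # insert_layer (\<phi> \<^bold>\<odot> \<psi>) L"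

primrec layers :: "'a form list \<Rightarrow> 'a form list" where
  "layers [] = []"
| "layers (\<phi> # L) = insert_layer \<phi> (layers L)"

lemma length_insert_layer [simp]: "length (insert_layer \<phi> L) = Suc (length L)"
  by (induction L arbitrary: \<phi>) auto

lemma length_layers [simp]: "length (layers L) = length L"
  by (induction L) auto

text \<open>At each layer \<phi> \<oplus> \<psi> keeps what fits and \<phi> \<odot> \<psi> passes
  the overflow on, so \<open>fp_plus\<close> preserves the total.\<close>

lemma fp_insert_layer:
  "fp_entails (\<lambda>v. (\<Sum>\<psi>\<leftarrow>insert_layer \<phi> L. v \<psi>) = v \<phi> + (\<Sum>\<psi>\<leftarrow>L. v \<psi>))"
proof (induction L arbitrary: \<phi>)
  case Nil
  show ?case by (rule fp_entails_trivial) simp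
next
  case (Cons \<psi> L)
  show ?case
    by (rule fp_entails_mono[OF fp_entails_conj[OF Cons[of "\<phi> \<^bold>\<odot> \<psi>"] fp_plus[of \<phi> \<psi>]]]) simp
qed

lemma fp_layers: "fp_entails (\<lambda>v. (\<Sum>\<psi>\<leftarrow>layers L. v \<psi>) = (\<Sum>\<psi>\<leftarrow>L. v \<psi>))"
proof (induction L)
  case Nil
  show ?case by (rule fp_entails_trivial) simp
next
  case (Cons \<phi> L)
  show ?case
    by (rule fp_entails_mono[OF fp_entails_conj[OF Cons fp_insert_layer[of \<phi> "layers L"]]]) simp
qed

text \<open>For entries in [0,1] this is the shape 1, ..., 1, x, 0, ..., 0, in which a sum of at
  least m forces the first m entries to be 1.\<close>

fun staircase :: "real list \<Rightarrow> bool" where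
  "staircase [] \<longleftrightarrow> True"
| "staircase (x # xs) \<longleftrightarrow> staircase xs \<and> (x < 1 \<longrightarrow> (\<forall>y\<in>set xs. y = 0))"

lemma sum_list_all_zero: "\<forall>y\<in>set xs. y = 0 \<Longrightarrow> sum_list xs = (0 :: real)"
  by (induction xs) auto

lemma staircase_nth:
  assumes "staircase xs" "\<And>x. x \<in> set xs \<Longrightarrow> x \<le> 1" "real m \<le> sum_list xs" "i < m" "i < length xs"
  shows "xs ! i = 1"
  using assms
proof (induction xs arbitrary: m i)
  case (Cons x xs)
  have "x = 1"
  proof (rule ccontr)
    assume "x \<noteq> 1"
    then have "x < 1" using Cons.prems(2)[of x] by simp
    then have "sum_list xs = 0" using Cons.prems(1) by (intro sum_list_all_zero) simp
    then show False using \<open>x < 1\<close> Cons.prems(3,4) by simp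
  qed
  then show ?case
    using Cons.prems Cons.IH[of "m - 1" "i - 1"] by (cases i) auto
qed simp

context
  fixes w :: "'a \<Rightarrow> real"
  assumes w: "\<And>p. w p \<in> {0..1}"
begin

lemma sum_insert_layer:
  "(\<Sum>\<psi>\<leftarrow>insert_layer \<phi> L. luk_val w \<psi>) = luk_val w \<phi> + (\<Sum>\<psi>\<leftarrow>L. luk_val w \<psi>)"
  by (induction L arbitrary: \<phi>) (auto simp: luk_val_Times[OF w] min_def max_def)

lemma sum_layers: "(\<Sum>\<psi>\<leftarrow>layers L. luk_val w \<psi>) = (\<Sum>\<psi>\<leftarrow>L. luk_val w \<psi>)"
  by (induction L) (auto simp: sum_insert_layer)

lemma staircase_insert_layer:
  "staircase (map (luk_val w) L) \<Longrightarrow> staircase (map (luk_val w) (insert_layer \<phi> L))"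
proof (induction L arbitrary: \<phi>)
  case (Cons \<psi> L)
  note nonneg = luk_val_range(1)[of w, OF w]
  \<comment> \<open>If the first layer is not full, nothing overflows: \<phi> \<odot> \<psi> is 0
    and, since \<psi> is below 1, so is all of L. The new tail has nonnegative values with sum
    0.\<close>
  have zero: "luk_val w \<theta> = 0"
    if "luk_val w (\<phi> \<^bold>\<oplus> \<psi>) < 1" "\<theta> \<in> set (insert_layer (\<phi> \<^bold>\<odot> \<psi>) L)" for \<theta>
  proof -
    have "luk_val w \<phi> + luk_val w \<psi> < 1" using that(1) by (auto simp: min_def split: if_splits)
    then have "luk_val w (\<phi> \<^bold>\<odot> \<psi>) = 0" "luk_val w \<psi> < 1"
      using nonneg[of \<phi>] by (auto simp: luk_val_Times[OF w])
    moreover from this have "(\<Sum>\<theta>\<leftarrow>L. luk_val w \<theta>) = 0"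
      using Cons.prems by (intro sum_list_all_zero) simp
    ultimately have "(\<Sum>\<theta>\<leftarrow>insert_layer (\<phi> \<^bold>\<odot> \<psi>) L. luk_val w \<theta>) = 0"
      by (simp add: sum_insert_layer)
    then show ?thesis
      using that(2) nonneg by (subst (asm) sum_list_nonneg_eq_0_iff) auto
  qed
  have "staircase (map (luk_val w) L)" using Cons.prems by simp
  then have "staircase (map (luk_val w) (insert_layer (\<phi> \<^bold>\<odot> \<psi>) L))" by (rule Cons.IH)
  with zero show ?case
    unfolding insert_layer.simps list.map staircase.simps set_map by blast
qed simp

lemma staircase_layers: "staircase (map (luk_val w) (layers L))"
  by (induction L) (auto intro: staircase_insert_layer)

end

lemma fp_sum_ge:
  assumes ge: "\<And>w. (\<And>p. w p \<in> {0..1}) \<Longrightarrow> real m \<le> (\<Sum>\<phi>\<leftarrow>L. luk_val w \<phi>)"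
  shows "fp_entails (\<lambda>v. real m \<le> (\<Sum>\<phi>\<leftarrow>L. v \<phi>))"
proof -
  \<comment> \<open>One valuation is enough to see that m is at most the number of summands, so the
    first m layers exist.\<close>
  have "(\<Sum>\<phi>\<leftarrow>L. luk_val (\<lambda>_. 0) \<phi>) \<le> (\<Sum>\<phi>\<leftarrow>L. 1)"
    by (rule sum_list_mono) (rule luk_val_range, simp)
  then have "m \<le> length L"
    using ge[of "\<lambda>_. 0"] by (simp add: sum_list_triv)
  have "luk_val w (layers L ! i) = 1" if "i < m" "\<And>p. w p \<in> {0..1}" for i w
  proof -
    have "map (luk_val w) (layers L) ! i = 1"
      using that(1) \<open>m \<le> length L\<close> ge[OF that(2)]
      by (intro staircase_nth[of _ m] staircase_layers[OF that(2)])
         (auto simp: sum_layers[OF that(2)] luk_val_range[of w, OF that(2)])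
    then show ?thesis using that(1) \<open>m \<le> length L\<close> by simp
  qed
  then have "fp_entails (\<lambda>v. \<forall>i\<in>{..<m}. v (layers L ! i) = 1)"
    by (intro fp_entails_ball fp_valid) auto
  from fp_entails_conj[OF this fp_layers] show ?thesis
  proof (rule fp_entails_mono)
    fix v :: "event \<Rightarrow> real"
    assume v: "\<And>p. v p \<in> {0..1}"
      and "(\<forall>i\<in>{..<m}. v (layers L ! i) = 1) \<and> (\<Sum>\<psi>\<leftarrow>layers L. v \<psi>) = (\<Sum>\<psi>\<leftarrow>L. v \<psi>)"
    then have eq: "(\<Sum>\<psi>\<leftarrow>layers L. v \<psi>) = (\<Sum>\<psi>\<leftarrow>L. v \<psi>)"
      and "real m = (\<Sum>i<m. v (layers L ! i))" by simp_all
    note this(2)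
    also have "(\<Sum>i<m. v (layers L ! i)) \<le> (\<Sum>i<length L. v (layers L ! i))"
      using \<open>m \<le> length L\<close> v by (intro sum_mono2) auto
    also have "\<dots> = (\<Sum>\<psi>\<leftarrow>L. v \<psi>)"
      unfolding eq[symmetric] by (simp add: sum_list_sum_nth lessThan_atLeast0)
    finally show "real m \<le> (\<Sum>\<psi>\<leftarrow>L. v \<psi>)" .
  qed
qed

text \<open>Negative coefficients are removed by \<open>- x = (1 - x) - 1\<close>.\<close>

lemma fp_linear:
  fixes a :: "event \<Rightarrow> int"
  assumes "finite F"
    and nonneg: "\<And>w. (\<And>p. w p \<in> {0..1}) \<Longrightarrow> 0 \<le> (\<Sum>\<phi>\<in>F. a \<phi> * luk_val w \<phi>)"
  shows "fp_entails (\<lambda>v. 0 \<le> (\<Sum>\<phi>\<in>F. a \<phi> * v \<phi>))"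
proof -
  obtain xs where xs: "set xs = F" "distinct xs" using finite_distinct_list[OF assms(1)] by blast
  define L where "L = concat (map (\<lambda>\<phi>. if a \<phi> \<ge> 0 then replicate (nat (a \<phi>)) \<phi>
    else replicate (nat (- a \<phi>)) (\<^bold>\<not> \<phi>)) xs)"
  define m where "m = (\<Sum>\<phi>\<in>F. nat (- a \<phi>))"
  have sum_L: "(\<Sum>\<phi>\<leftarrow>L. f \<phi>) = (\<Sum>\<phi>\<in>F. a \<phi> * f \<phi>) + real m"
    if "\<forall>\<phi>\<in>F. f (\<^bold>\<not> \<phi>) = 1 - f \<phi>" for f :: "event \<Rightarrow> real"
  proof -
    have "(\<Sum>\<phi>\<leftarrow>L. f \<phi>) = (\<Sum>\<phi>\<leftarrow>xs. if a \<phi> \<ge> 0 then a \<phi> * f \<phi> else - a \<phi> * f (\<^bold>\<not> \<phi>))"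
      unfolding L_def by (induction xs) (auto simp: sum_list_replicate)
    also have "\<dots> = (\<Sum>\<phi>\<in>F. if a \<phi> \<ge> 0 then a \<phi> * f \<phi> else - a \<phi> * f (\<^bold>\<not> \<phi>))"
      using xs by (simp add: sum_list_distinct_conv_sum_set)
    also have "\<dots> = (\<Sum>\<phi>\<in>F. a \<phi> * f \<phi> + real (nat (- a \<phi>)))"
      using that by (intro sum.cong) (auto simp: right_diff_distrib)
    finally show ?thesis by (simp add: sum.distrib m_def)
  qed
  have "fp_entails (\<lambda>v. real m \<le> (\<Sum>\<phi>\<leftarrow>L. v \<phi>))"
    using nonneg by (intro fp_sum_ge) (simp add: sum_L)
  moreover have "fp_entails (\<lambda>v. \<forall>\<phi>\<in>F. v (\<^bold>\<not> \<phi>) = 1 - v \<phi>)"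
    using assms(1) fp_neg by (intro fp_entails_ball)
  ultimately have "fp_entails (\<lambda>v. real m \<le> (\<Sum>\<phi>\<leftarrow>L. v \<phi>) \<and> (\<forall>\<phi>\<in>F. v (\<^bold>\<not> \<phi>) = 1 - v \<phi>))"
    by (rule fp_entails_conj)
  then show ?thesis by (rule fp_entails_mono) (use sum_L in auto)
qed

section \<open>States as mixtures of valuations\<close>

text \<open>
  The variable \<open>(None, \<theta>)\<close> is the probability of \<open>\<theta>\<close>, and \<open>(Some \<sigma>, \<theta>)\<close> is the contribution to it
  of the region of the cube where exactly the formulas in \<open>\<sigma>\<close> take the value 1.
\<close>

definition lift_ineq :: "'s \<Rightarrow> 'v multiset \<times> 'v multiset \<Rightarrow> ('s \<times> 'v) multiset \<times> ('s \<times> 'v) multiset"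
  where "lift_ineq s = map_prod (image_mset (Pair s)) (image_mset (Pair s))"

lemma ineq_holds_lift: "ineq_holds x (lift_ineq s c) \<longleftrightarrow> ineq_holds (\<lambda>i. x (s, i)) c"
  by (cases c) (simp add: ineq_holds_def lift_ineq_def multiset.map_comp comp_def)

lemma ineq_vars_lift: "ineq_vars (lift_ineq s c) = Pair s ` ineq_vars c"
  by (cases c) (auto simp: ineq_vars_def lift_ineq_def)

text \<open>The disjunctive description of the hull of a union of polyhedra: each region has its own
  copy of its homogeneous system, and the copies are added up.\<close>

definition mixture_ineqs ::
    "'a form set \<Rightarrow> (('a form set option \<times> 'a form) multiset \<times> ('a form set option \<times> 'a form) multiset) set"
  where "mixture_ineqs F =
    (\<Union>\<sigma>\<in>Pow F. lift_ineq (Some \<sigma>) ` val_ineqs F \<sigma>) \<union>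
    (\<Union>\<theta>\<in>F. let S = image_mset (\<lambda>\<sigma>. (Some \<sigma>, \<theta>)) (mset_set (Pow F))
      in {({#(None, \<theta>)#}, S), (S, {#(None, \<theta>)#})})"

text \<open>Solutions within one region add up to a solution of the same region, so one valuation
  per region suffices and the regions can serve as indices. The total weight is left open; once
  \<top> is in F it equals y(\<top>).\<close>

inductive mixture_of_vals :: "'a form set \<Rightarrow> ('a form \<Rightarrow> real) \<Rightarrow> bool" for F y where
  mixture: "finite (I :: 'a form set set) \<Longrightarrow> \<forall>\<sigma>\<in>I. 0 \<le> c \<sigma> \<Longrightarrow> \<forall>\<sigma>\<in>I. \<forall>p. w \<sigma> p \<in> {0..1} \<Longrightarrow>
    \<forall>\<theta>\<in>F. y \<theta> = (\<Sum>\<sigma>\<in>I. c \<sigma> * luk_val (w \<sigma>) \<theta>) \<Longrightarrow> mixture_of_vals F y"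

lemma mixture_sum_iff:
  assumes "finite F"
  shows "(\<forall>c \<in> (let S = image_mset (\<lambda>\<sigma>. (Some \<sigma>, \<theta>)) (mset_set (Pow F))
      in {({#(None, \<theta>)#}, S), (S, {#(None, \<theta>)#})}). ineq_holds x c)
    \<longleftrightarrow> x (None, \<theta>) = (\<Sum>\<sigma>\<in>Pow F. x (Some \<sigma>, \<theta>))"
  by (auto simp: ineq_holds_def Let_def multiset.map_comp comp_def sum_unfold_sum_mset)

lemma mixture_ineqs_vars:
  assumes "sub_closed F" "\<^bold>\<top> \<in> F" "finite F" "c \<in> mixture_ineqs F"
  shows "ineq_vars c \<subseteq> insert None (Some ` Pow F) \<times> F"
proof -
  let ?S = "\<lambda>\<theta>. image_mset (\<lambda>\<sigma>. (Some \<sigma>, \<theta>)) (mset_set (Pow F))"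
  consider (val) \<sigma> d where "\<sigma> \<in> Pow F" "d \<in> val_ineqs F \<sigma>" "c = lift_ineq (Some \<sigma>) d"
    | (sum) \<theta> where "\<theta> \<in> F" "c = ({#(None, \<theta>)#}, ?S \<theta>) \<or> c = (?S \<theta>, {#(None, \<theta>)#})"
    using assms(4) unfolding mixture_ineqs_def Let_def by blast
  then show ?thesis
  proof cases
    case val
    then show ?thesis
      using val_ineqs_vars[OF assms(1,2) val(2)] by (auto simp: ineq_vars_lift)
  next
    case sum
    then show ?thesis using assms(3) by (auto simp: ineq_vars_def)
  qed
qed

lemma finite_mixture_ineqs: "finite F \<Longrightarrow> finite (mixture_ineqs F)"
  unfolding mixture_ineqs_def Let_def
  by (intro finite_UnI finite_UN_I finite_imageI finite_val_ineqs finite.intros) simp_all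

text \<open>A single valuation is the mixture with all its weight in its own region \<tau>; on the
  other blocks 0 solves the homogeneous system.\<close>

lemma mixture_ineqs_luk_val:
  fixes w :: "'a \<Rightarrow> real"
  assumes "\<And>p. w p \<in> {0..1}" "finite F" "c \<in> mixture_ineqs F"
  defines "\<tau> \<equiv> {\<phi> \<in> F. luk_val w \<phi> = 1}"
  shows "ineq_holds (\<lambda>(s, \<theta>). if s = None \<or> s = Some \<tau> then luk_val w \<theta> else 0) c"
proof -
  let ?x = "\<lambda>(s, \<theta>). if s = None \<or> s = Some \<tau> then luk_val w \<theta> else 0"
  have "ineq_holds ?x (lift_ineq (Some \<sigma>) d)" if "d \<in> val_ineqs F \<sigma>" for \<sigma> d
  proof (cases "\<sigma> = \<tau>")
    case True
    have "ineq_holds (luk_val w) d"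
      by (rule val_ineqs_luk_val[OF assms(1) _ that]) (auto simp: True \<tau>_def)
    then show ?thesis by (simp add: ineq_holds_lift True)
  next
    case False
    then show ?thesis by (cases d) (simp add: ineq_holds_lift, simp add: ineq_holds_def)
  qed
  moreover have "?x (None, \<theta>) = (\<Sum>\<sigma>\<in>Pow F. ?x (Some \<sigma>, \<theta>))" for \<theta>
  proof -
    have "(\<Sum>\<sigma>\<in>Pow F. ?x (Some \<sigma>, \<theta>)) = (\<Sum>\<sigma>\<in>Pow F. if \<sigma> = \<tau> then luk_val w \<theta> else 0)"
      by (intro sum.cong) auto
    also have "\<dots> = luk_val w \<theta>" using assms(2) by (simp add: \<tau>_def)
    finally show ?thesis by simp
  qed
  ultimately show ?thesis
    using assms(3) mixture_sum_iff[OF assms(2), of _ ?x] unfolding mixture_ineqs_def by blast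
qed

lemma mixture_ineqs_solution:
  assumes F: "sub_closed F" "\<^bold>\<top> \<in> F" "finite F"
    and x: "\<And>c. c \<in> mixture_ineqs F \<Longrightarrow> ineq_holds x c"
  shows "mixture_of_vals F (\<lambda>\<theta>. x (None, \<theta>))"
proof -
  have br: "ineq_holds (\<lambda>\<theta>. x (Some \<sigma>, \<theta>)) d" if "\<sigma> \<in> Pow F" "d \<in> val_ineqs F \<sigma>" for \<sigma> d
    using x[of "lift_ineq (Some \<sigma>) d"] that by (auto simp: mixture_ineqs_def ineq_holds_lift)
  have ex: "\<forall>\<sigma>\<in>Pow F. \<exists>w. (\<forall>p. w p \<in> {0..1}) \<and>
      (\<forall>\<theta>\<in>F. x (Some \<sigma>, \<theta>) = x (Some \<sigma>, \<^bold>\<top>) * luk_val w \<theta>)"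
  proof
    fix \<sigma> assume "\<sigma> \<in> Pow F"
    from val_ineqs_solution[OF F(1,2) br[OF this]]
    show "\<exists>w. (\<forall>p. w p \<in> {0..1}) \<and>
        (\<forall>\<theta>\<in>F. x (Some \<sigma>, \<theta>) = x (Some \<sigma>, \<^bold>\<top>) * luk_val w \<theta>)"
      by metis
  qed
  from bchoice[OF ex] obtain w where w: "\<forall>\<sigma>\<in>Pow F. (\<forall>p. w \<sigma> p \<in> {0..1}) \<and>
      (\<forall>\<theta>\<in>F. x (Some \<sigma>, \<theta>) = x (Some \<sigma>, \<^bold>\<top>) * luk_val (w \<sigma>) \<theta>)"
    by blast
  have "0 \<le> x (Some \<sigma>, \<^bold>\<top>)" if "\<sigma> \<in> Pow F" for \<sigma>
    using br[OF that, of "({#}, {#\<^bold>\<top>#})"] F(2) by (auto simp: val_ineqs_def ineq_holds_def)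
  moreover have "x (None, \<theta>) = (\<Sum>\<sigma>\<in>Pow F. x (Some \<sigma>, \<^bold>\<top>) * luk_val (w \<sigma>) \<theta>)"
    if "\<theta> \<in> F" for \<theta>
  proof -
    have "x (None, \<theta>) = (\<Sum>\<sigma>\<in>Pow F. x (Some \<sigma>, \<theta>))"
      using that x unfolding mixture_sum_iff[OF F(3), symmetric] mixture_ineqs_def by blast
    also have "\<dots> = (\<Sum>\<sigma>\<in>Pow F. x (Some \<sigma>, \<^bold>\<top>) * luk_val (w \<sigma>) \<theta>)"
      using w that by (intro sum.cong) auto
    finally show ?thesis .
  qed
  ultimately show ?thesis
    using w F(3) by (intro mixture[of "Pow F" "\<lambda>\<sigma>. x (Some \<sigma>, \<^bold>\<top>)" w]) auto
qed

text \<open>After the contributions of the regions are eliminated, each remaining inequality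
  concerns probabilities only. It lies in the cone of the mixture inequalities and so holds at every
  valuation, which is what \<open>fp_linear\<close> asks for.\<close>

lemma fp_mixture:
  assumes F: "sub_closed F" "\<^bold>\<top> \<in> F" "finite F"
  shows "fp_entails (mixture_of_vals F)"
proof -
  define V where "V = insert None (Some ` Pow F) \<times> F"
  define W where "W = Some ` Pow F \<times> F"
  let ?K = "mixture_ineqs F"
  have VW: "finite V" "finite W" "W \<subseteq> V" using F(3) by (auto simp: V_def W_def)
  obtain S where S: "finite S" "S \<subseteq> int_cone (ineq_form ` ?K)" "\<forall>l\<in>S. \<forall>i\<in>W. l i = 0"
    "\<forall>y. (\<forall>l\<in>S. 0 \<le> form_val V l y) \<longrightarrow>
      (\<exists>x. (\<forall>i. i \<notin> W \<longrightarrow> x i = y i) \<and> (\<forall>l\<in>ineq_form ` ?K. 0 \<le> form_val V l x))"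
    using fourier_motzkin[OF VW(2) finite_imageI[OF finite_mixture_ineqs[OF F(3)], of ineq_form] VW(1,3)]
    by auto
  have val: "form_val V l y = (\<Sum>\<theta>\<in>F. l (None, \<theta>) * y (None, \<theta>))" if "l \<in> S" for l y
  proof -
    have "form_val V l y = (\<Sum>i\<in>Pair None ` F. l i * y i)"
      unfolding form_val_def using VW(1) S(3) that
      by (intro sum.mono_neutral_right) (auto simp: V_def W_def)
    then show ?thesis by (simp add: sum.reindex inj_on_def)
  qed
  have ineq: "0 \<le> form_val V (ineq_form c) x \<longleftrightarrow> ineq_holds x c" if "c \<in> ?K" for c x
    using VW(1) mixture_ineqs_vars[OF F that] unfolding V_def by (rule form_val_ineq)
  have "fp_entails (\<lambda>v. 0 \<le> (\<Sum>\<theta>\<in>F. l (None, \<theta>) * v \<theta>))" if l: "l \<in> S" for l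
  proof (rule fp_linear[OF F(3)])
    fix w :: "nat \<Rightarrow> real"
    assume w: "\<And>p. w p \<in> {0..1}"
    define y :: "event set option \<times> event \<Rightarrow> real" where
      "y = (\<lambda>(s, \<theta>). if s = None \<or> s = Some {\<phi> \<in> F. luk_val w \<phi> = 1} then luk_val w \<theta> else 0)"
    have "0 \<le> form_val V m y" if "m \<in> ineq_form ` ?K" for m
      using that ineq mixture_ineqs_luk_val[OF w F(3)] unfolding y_def by auto
    then have "0 \<le> form_val V l y"
      using l S(2) int_cone_form_val_nonneg by blast
    then show "0 \<le> (\<Sum>\<theta>\<in>F. l (None, \<theta>) * luk_val w \<theta>)"
      by (simp add: val[OF l] y_def)
  qed
  then have "fp_entails (\<lambda>v. \<forall>l\<in>S. 0 \<le> (\<Sum>\<theta>\<in>F. l (None, \<theta>) * v \<theta>))"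
    by (intro fp_entails_ball S(1))
  then show ?thesis
  proof (rule fp_entails_mono)
    fix v :: "event \<Rightarrow> real"
    assume "\<forall>l\<in>S. 0 \<le> (\<Sum>\<theta>\<in>F. l (None, \<theta>) * v \<theta>)"
    \<comment> \<open>The values given to the coordinates in W are arbitrary: forms in S vanish
      there, and the solution x replaces them.\<close>
    then have "\<forall>l\<in>S. 0 \<le> form_val V l (\<lambda>(s, \<theta>). v \<theta>)" by (simp add: val)
    then obtain x where x: "\<forall>i. i \<notin> W \<longrightarrow> x i = (\<lambda>(s, \<theta>). v \<theta>) i"
      "\<forall>l\<in>ineq_form ` ?K. 0 \<le> form_val V l x"
      using S(4)[rule_format, of "\<lambda>(s, \<theta>). v \<theta>"] by auto
    have "mixture_of_vals F (\<lambda>\<theta>. x (None, \<theta>))"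
      using x(2) ineq by (intro mixture_ineqs_solution[OF F]) auto
    then show "mixture_of_vals F v" using x(1) by (simp add: W_def image_iff)
  qed
qed

section \<open>Completeness and soundness of FP with respect to states\<close>

lemma mv_eval_cong: "(\<And>p. p \<in> atoms \<phi> \<Longrightarrow> v p = w p) \<Longrightarrow> mv_eval A v \<phi> = mv_eval A w \<phi>"
  by (induction \<phi>) (auto simp: mv_eval.simps)

lemma finite_atoms: "finite (atoms \<phi>)"
  by (induction \<phi>) auto

lemma FP_deriv_mono: "\<Gamma> \<turnstile>\<^sub>F\<^sub>P \<Phi> \<Longrightarrow> \<Gamma> \<subseteq> \<Delta> \<Longrightarrow> \<Delta> \<turnstile>\<^sub>F\<^sub>P \<Phi>"
  by (induction rule: FP_deriv.induct) (auto intro: FP_deriv.intros)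

lemma luk_deriv_FP:
  assumes "luk_deriv \<Gamma> \<Phi>" "\<And>\<Psi>. \<Psi> \<in> \<Gamma> \<Longrightarrow> \<Delta> \<turnstile>\<^sub>F\<^sub>P \<Psi>"
  shows "\<Delta> \<turnstile>\<^sub>F\<^sub>P \<Phi>"
  using assms by (induction rule: luk_deriv.induct) (auto intro: FP_deriv.intros)

lemma unit_MV_simps:
  "mv_zero unit_MV = 0" "mv_neg unit_MV x = 1 - x" "mv_plus unit_MV x y = min 1 (x + y)"
  by (simp_all add: unit_MV_def)

text \<open>If f \<odot> g is zero then f + g \<le> 1 at every point, so \<oplus> is plain addition
  there and a weighted mean of point evaluations respects it.\<close>

lemma is_state_mixture:
  assumes "finite I" "\<And>i. i \<in> I \<Longrightarrow> 0 \<le> c i" "sum c I = 1" "\<And>i. i \<in> I \<Longrightarrow> pt i \<in> cube n"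
  shows "is_state (Free_MV n) (\<lambda>f. \<Sum>i\<in>I. c i * f (pt i))"
  unfolding is_state_def
proof (intro conjI ballI impI funcsetI)
  have car: "f x \<in> {0..1}" if "f \<in> mv_carrier (Free_MV n)" "x \<in> cube n" for f x
    using that by (auto simp: Free_MV_def mcnaughton_def)
  show "(\<Sum>i\<in>I. c i * f (pt i)) \<in> {0..1}" if "f \<in> mv_carrier (Free_MV n)" for f
  proof -
    have "(\<Sum>i\<in>I. c i * f (pt i)) \<le> (\<Sum>i\<in>I. c i * 1)"
      using car[OF that] assms(2,4) by (intro sum_mono mult_left_mono) auto
    moreover have "0 \<le> (\<Sum>i\<in>I. c i * f (pt i))"
      using car[OF that] assms(2,4) by (intro sum_nonneg mult_nonneg_nonneg) auto
    ultimately show ?thesis using assms(3) by simp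
  qed
  show "(\<Sum>i\<in>I. c i * mv_one (Free_MV n) (pt i)) = 1"
    using assms(3,4) by (simp add: mv_one_def Free_MV_def unit_MV_simps)
  fix f g
  assume f: "f \<in> mv_carrier (Free_MV n)" and g: "g \<in> mv_carrier (Free_MV n)"
    and disj: "mv_times (Free_MV n) f g = mv_zero (Free_MV n)"
  have "mv_plus (Free_MV n) f g x = f x + g x" if "x \<in> cube n" for x
  proof -
    have "mv_times (Free_MV n) f g x = 0"
      unfolding disj using that by (simp add: Free_MV_def unit_MV_simps)
    then show ?thesis
      using that by (simp add: Free_MV_def unit_MV_simps mv_times_def min_def split: if_splits)
  qed
  then show "(\<Sum>i\<in>I. c i * mv_plus (Free_MV n) f g (pt i))
      = (\<Sum>i\<in>I. c i * f (pt i)) + (\<Sum>i\<in>I. c i * g (pt i))"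
    using assms(4) by (simp add: sum.distrib[symmetric] distrib_left)
qed

theorem FP_complete:
  assumes e: "bij_betw e E {..<n}" and E: "event_vars \<Phi> \<subseteq> E" "event_vars \<Psi> \<subseteq> E"
    and states: "\<And>s. is_state (Free_MV n) s \<Longrightarrow> state_sat n e s \<Phi> \<Longrightarrow> state_sat n e s \<Psi>"
  shows "{\<Phi>} \<turnstile>\<^sub>F\<^sub>P \<Psi>"
proof -
  define F where "F = (\<Union>\<theta>\<in>insert \<^bold>\<top> (atoms \<Phi> \<union> atoms \<Psi>). subforms \<theta>)"
  have "sub_closed F" unfolding F_def by (rule sub_closed_UN) (rule sub_closed_subforms)
  moreover have in_F: "\<^bold>\<top> \<in> F" "atoms \<Phi> \<subseteq> F" "atoms \<Psi> \<subseteq> F"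
    using self_in_subforms unfolding F_def by blast+
  moreover have "finite F" by (simp add: F_def finite_atoms finite_subforms)
  ultimately have "fp_entails (mixture_of_vals F)" by (intro fp_mixture)
  \<comment> \<open>This makes the weights of the mixture sum to 1.\<close>
  moreover have "fp_entails (\<lambda>v. v \<^bold>\<top> = 1)" by (rule fp_valid) simp
  ultimately have "fp_entails (\<lambda>v. mixture_of_vals F v \<and> v \<^bold>\<top> = 1)" by (rule fp_entails_conj)
  then obtain G where G: "finite G" "\<forall>\<gamma>\<in>G. {} \<turnstile>\<^sub>F\<^sub>P \<gamma>"
    "\<forall>v. (\<forall>p. v p \<in> {0..1}) \<longrightarrow> (\<forall>\<gamma>\<in>G. luk_val v \<gamma> = 1) \<longrightarrow> mixture_of_vals F v \<and> v \<^bold>\<top> = 1"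
    unfolding fp_entails_def by metis
  have "luk_deriv (insert \<Phi> G) \<Psi>"
  proof (rule finite_strong_completeness)
    fix v :: "event \<Rightarrow> real"
    assume v: "\<And>p. v p \<in> {0..1}" "\<And>\<gamma>. \<gamma> \<in> insert \<Phi> G \<Longrightarrow> luk_val v \<gamma> = 1"
    then have "mixture_of_vals F v" "v \<^bold>\<top> = 1" using G(3) by auto
    from this(1) obtain I :: "event set set" and c w where mix: "finite I" "\<forall>\<sigma>\<in>I. 0 \<le> c \<sigma>"
      "\<forall>\<sigma>\<in>I. \<forall>p. w \<sigma> p \<in> {0..1}" "\<forall>\<theta>\<in>F. v \<theta> = (\<Sum>\<sigma>\<in>I. c \<sigma> * luk_val (w \<sigma>) \<theta>)"
      by (rule mixture_of_vals.cases)
    \<comment> \<open>The valuation of a region becomes a point of the cube by renumbering the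
      variables in E; the events of \<Phi> and \<Psi> do not see any others.\<close>
    define pt where "pt \<sigma> = (\<lambda>j\<in>{..<n}. w \<sigma> (inv_into E e j))" for \<sigma>
    define s where "s f = (\<Sum>\<sigma>\<in>I. c \<sigma> * f (pt \<sigma>))" for f :: "(nat \<Rightarrow> real) \<Rightarrow> real"
    have pt: "pt \<sigma> \<in> cube n" if "\<sigma> \<in> I" for \<sigma>
      using mix(3) that by (auto simp: pt_def cube_def)
    have "sum c I = 1" using mix(4) in_F(1) \<open>v \<^bold>\<top> = 1\<close> by simp
    then have "is_state (Free_MV n) s"
      unfolding s_def using mix pt by (intro is_state_mixture) auto
    have ev: "s (mcn_fun n e \<theta>) = v \<theta>" if "\<theta> \<in> F" "atoms \<theta> \<subseteq> E" for \<theta>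
    proof -
      have "luk_val (\<lambda>p. pt \<sigma> (e p)) \<theta> = luk_val (w \<sigma>) \<theta>" for \<sigma>
      proof (rule mv_eval_cong)
        fix p assume "p \<in> atoms \<theta>"
        then have "p \<in> E" using that(2) by blast
        then show "pt \<sigma> (e p) = w \<sigma> p"
          using e by (auto simp: pt_def bij_betw_def)
      qed
      then show ?thesis
        using mix(4) that(1) pt by (simp add: s_def mcn_fun_def)
    qed
    have sat: "state_sat n e s \<Theta> \<longleftrightarrow> luk_val v \<Theta> = 1" if "atoms \<Theta> \<subseteq> F" "event_vars \<Theta> \<subseteq> E" for \<Theta>
    proof -
      have "luk_val (\<lambda>\<phi>. s (mcn_fun n e \<phi>)) \<Theta> = luk_val v \<Theta>"
        by (rule mv_eval_cong, rule ev) (use that in \<open>auto simp: event_vars_def\<close>)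
      then show ?thesis by (simp add: state_sat_def)
    qed
    have "state_sat n e s \<Phi>" using sat[OF in_F(2) E(1)] v(2) by simp
    then have "state_sat n e s \<Psi>" using states \<open>is_state (Free_MV n) s\<close> by simp
    then show "luk_val v \<Psi> = 1" using sat[OF in_F(3) E(2)] by simp
  qed (use G(1) in simp)
  then show ?thesis
    by (rule luk_deriv_FP) (use G(2) FP_deriv_mono FP_deriv.hyp in auto)
qed

text \<open>The hypothesis \<open>add\<close> speaks of values at all [0,1]-valuations, so it
  applies to every event that is pointwise the sum of two others. The axioms for P are checked by
  finding such decompositions.\<close>

lemma FP_sound:
  assumes "\<Gamma> \<turnstile>\<^sub>F\<^sub>P \<Phi>" and hyps: "\<And>\<Theta>. \<Theta> \<in> \<Gamma> \<Longrightarrow> luk_val v \<Theta> = 1"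
    and range: "\<And>\<phi>. v \<phi> \<in> {0..1}"
    and top: "v \<^bold>\<top> = 1"
    and add: "\<And>\<phi> \<psi> \<theta>. (\<And>w. (\<And>p. w p \<in> {0..1}) \<Longrightarrow> luk_val w \<theta> = luk_val w \<phi> + luk_val w \<psi>)
      \<Longrightarrow> v \<theta> = v \<phi> + v \<psi>"
  shows "luk_val v \<Phi> = 1"
proof -
  have neg: "v (\<^bold>\<not> \<phi>) = 1 - v \<phi>" for \<phi>
    using add[of "\<^bold>\<top>" \<phi> "\<^bold>\<not> \<phi>"] top by simp
  have mono: "v \<phi> \<le> v \<psi>" if "\<And>w. (\<And>p. w p \<in> {0..1}) \<Longrightarrow> luk_val w \<phi> \<le> luk_val w \<psi>" for \<phi> \<psi>
  proof -
    have "v \<psi> = v \<phi> + v (\<psi> \<^bold>\<odot> \<^bold>\<not> \<phi>)"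
      by (rule add) (use that in \<open>auto simp: luk_val_Times\<close>)
    then show ?thesis using range[of "\<psi> \<^bold>\<odot> \<^bold>\<not> \<phi>"] by simp
  qed
  have plus: "v (\<phi> \<^bold>\<oplus> \<psi>) + v (\<phi> \<^bold>\<odot> \<psi>) = v \<phi> + v \<psi>" for \<phi> \<psi>
  proof -
    \<comment> \<open>The part of \<psi> left after removing \<phi> \<odot> \<psi>, with value
      min(\<psi>, 1 - \<phi>): exactly what can be put on top of \<phi> without truncation.\<close>
    let ?\<delta> = "\<psi> \<^bold>\<odot> \<^bold>\<not> (\<phi> \<^bold>\<odot> \<psi>)"
    have "luk_val w ?\<delta> = min (luk_val w \<psi>) (1 - luk_val w \<phi>)" if "\<And>p. w p \<in> {0..1}" for w
      using luk_val_range[of w \<phi>, OF that] luk_val_range[of w \<psi>, OF that]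
      by (simp add: luk_val_Times[OF that])
    then have "v (\<phi> \<^bold>\<oplus> \<psi>) = v \<phi> + v ?\<delta>" "v \<psi> = v (\<phi> \<^bold>\<odot> \<psi>) + v ?\<delta>"
      by (intro add; simp add: luk_val_Times min_def max_def)+
    then show ?thesis by simp
  qed
  from assms(1) show ?thesis
  proof (induction rule: FP_deriv.induct)
    case (hyp \<Phi>)
    then show ?case by (rule hyps)
  next
    case (ax \<Phi>)
    then show ?case by (intro luk_axiom_valid[OF range])
  next
    case (P1 \<phi>)
    then show ?case by (simp add: luk_val_Iff[OF range] neg)
  next
    case (P2 \<phi> \<psi>)
    \<comment> \<open>Modus ponens for truth values: (\<phi> \<rightarrow> \<psi>) \<odot> \<phi> is
      the minimum of \<phi> and \<psi>.\<close>
    have "v ((\<phi> \<^bold>\<rightarrow> \<psi>) \<^bold>\<odot> \<phi>) \<le> v \<psi>"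
      by (rule mono) (use luk_val_range(1) in \<open>auto simp: luk_val_Times min_def\<close>)
    then have "v (\<phi> \<^bold>\<rightarrow> \<psi>) + v \<phi> \<le> 1 + v \<psi>"
      using plus[of "\<phi> \<^bold>\<rightarrow> \<psi>" \<phi>] range[of "(\<phi> \<^bold>\<rightarrow> \<psi>) \<^bold>\<oplus> \<phi>"] by simp
    then show ?case using range[of "\<phi> \<^bold>\<rightarrow> \<psi>"] by (simp add: luk_val_imp_eq_1)
  next
    case (P3 \<phi> \<psi>)
    have "v (\<phi> \<^bold>\<odot> \<psi>) \<le> v \<phi>"
      by (rule mono) (simp add: luk_val_Times luk_val_range)
    then show ?case
      using plus[of \<phi> \<psi>] range[of "\<phi> \<^bold>\<oplus> \<psi>"] by (simp add: luk_val_Iff[OF range])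
  next
    case (mp \<Phi> \<Psi>)
    then have "luk_val v (\<Phi> \<^bold>\<rightarrow> \<Psi>) = 1" "luk_val v \<Phi> = 1" by auto
    then show ?case
      unfolding luk_val_imp_eq_1 using luk_val_range(2)[of v \<Psi>, OF range] by simp
  next
    case (N \<phi>)
    \<comment> \<open>A theorem has value 1 everywhere, so \<top> is pointwise \<phi> + \<bottom>;
      the second equation gives v(\<bottom>) = 0.\<close>
    have "v \<^bold>\<top> = v \<phi> + v \<^bold>\<bottom>" "v \<^bold>\<top> = v \<^bold>\<top> + v \<^bold>\<bottom>"
      by (rule add; simp add: luk_thm_valid[OF N])+
    then show ?case using top by simp
  qed
qed

theorem FP_sound_states:
  assumes deriv: "{\<Phi>} \<turnstile>\<^sub>F\<^sub>P \<Psi>"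
    and e: "e ` E \<subseteq> {..<n}" and E: "event_vars \<Phi> \<subseteq> E" "event_vars \<Psi> \<subseteq> E"
    and s: "is_state (Free_MV n) s" "state_sat n e s \<Phi>"
  shows "state_sat n e s \<Psi>"
proof -
  text \<open>A derivation may use variables outside \<open>E\<close>, on which \<open>e\<close> is arbitrary; they are read as \<open>\<bottom>\<close>.\<close>
  define w :: "(nat \<Rightarrow> real) \<Rightarrow> nat \<Rightarrow> real" where "w x p = (if p \<in> E then x (e p) else 0)" for x p
  define f where "f \<phi> = (\<lambda>x\<in>cube n. luk_val (w x) \<phi>)" for \<phi>
  have w: "w x p \<in> {0..1}" if "x \<in> cube n" for x p
    using that e by (force simp: w_def cube_def PiE_iff)
  have car: "f \<phi> \<in> mv_carrier (Free_MV n)" for \<phi>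
  proof -
    have "mcnaughton n (f \<phi>)"
    proof (induction \<phi>)
      case (Atom p)
      have "f (Atom p) = (if p \<in> E then (\<lambda>x\<in>cube n. x (e p)) else (\<lambda>x\<in>cube n. 0))"
        by (auto simp: f_def w_def)
      then show ?case using mcnaughton_zero mcnaughton_proj[of "e p" n] e by auto
    next
      case Bot
      have eq: "f \<^bold>\<bottom> = (\<lambda>x\<in>cube n. 0)" by (auto simp: f_def)
      show ?case unfolding eq by (rule mcnaughton_zero)
    next
      case (Neg \<phi>)
      have eq: "f (\<^bold>\<not> \<phi>) = (\<lambda>x\<in>cube n. 1 - f \<phi> x)" by (auto simp: f_def)
      show ?case unfolding eq by (rule mcnaughton_neg[OF Neg])
    next
      case (Plus \<phi> \<psi>)
      have eq: "f (\<phi> \<^bold>\<oplus> \<psi>) = (\<lambda>x\<in>cube n. min 1 (f \<phi> x + f \<psi> x))" by (auto simp: f_def)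
      show ?case unfolding eq by (rule mcnaughton_plus[OF Plus])
    qed
    then show ?thesis by (simp add: Free_MV_def)
  qed
  have sat: "state_sat n e s \<Theta> \<longleftrightarrow> luk_val (\<lambda>\<phi>. s (f \<phi>)) \<Theta> = 1" if "event_vars \<Theta> \<subseteq> E" for \<Theta>
  proof -
    have "f \<phi> = mcn_fun n e \<phi>" if "\<phi> \<in> atoms \<Theta>" for \<phi>
      unfolding f_def mcn_fun_def
      by (intro restrict_ext mv_eval_cong)
        (use that \<open>event_vars \<Theta> \<subseteq> E\<close> in \<open>auto simp: w_def event_vars_def\<close>)
    then have "luk_val (\<lambda>\<phi>. s (f \<phi>)) \<Theta> = luk_val (\<lambda>\<phi>. s (mcn_fun n e \<phi>)) \<Theta>"
      by (intro mv_eval_cong) simp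
    then show ?thesis by (simp add: state_sat_def)
  qed
  have "luk_val (\<lambda>\<phi>. s (f \<phi>)) \<Psi> = 1"
  proof (rule FP_sound[OF deriv])
    show "luk_val (\<lambda>\<phi>. s (f \<phi>)) \<Theta> = 1" if "\<Theta> \<in> {\<Phi>}" for \<Theta>
      using that s(2) sat[OF E(1)] by simp
    show "s (f \<phi>) \<in> {0..1}" for \<phi> using s(1) car unfolding is_state_def by blast
    have "f \<^bold>\<top> = mv_one (Free_MV n)"
      by (auto simp: f_def mv_one_def Free_MV_def unit_MV_simps)
    then show "s (f \<^bold>\<top>) = 1" using s(1) by (simp add: is_state_def)
    fix \<phi> \<psi> \<theta> :: event
    assume "\<And>w. (\<And>p. w p \<in> {0..1}) \<Longrightarrow> luk_val w \<theta> = luk_val w \<phi> + luk_val w \<psi>"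
    then have eq: "luk_val (w x) \<theta> = luk_val (w x) \<phi> + luk_val (w x) \<psi>" if "x \<in> cube n" for x
      using w[OF that] by blast
    \<comment> \<open>The sum is a truth value of \<theta>, hence at most 1. This makes f \<phi> and
      f \<psi> disjoint, so the state is additive on them.\<close>
    have le: "luk_val (w x) \<phi> + luk_val (w x) \<psi> \<le> 1" if "x \<in> cube n" for x
      using eq[OF that] luk_val_range(2)[of "w x" \<theta>, OF w[OF that]] by simp
    have "mv_times (Free_MV n) (f \<phi>) (f \<psi>) = mv_zero (Free_MV n)"
      using le by (fastforce simp: mv_times_def Free_MV_def unit_MV_simps f_def)
    moreover have "mv_plus (Free_MV n) (f \<phi>) (f \<psi>) = f \<theta>"
      using le eq by (fastforce simp: Free_MV_def unit_MV_simps f_def)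
    ultimately show "s (f \<theta>) = s (f \<phi>) + s (f \<psi>)"
      using s(1) car unfolding is_state_def by metis
  qed
  then show ?thesis using sat[OF E(2)] by simp
qed

theorem theorem2p16:
  fixes \<Phi> \<Psi> :: modal and n :: nat and e :: "nat \<Rightarrow> nat"
  assumes "bij_betw e (event_vars \<Phi> \<union> event_vars \<Psi>) {..<n}"
  shows "{\<Phi>} \<turnstile>\<^sub>F\<^sub>P \<Psi> \<longleftrightarrow>
    (\<forall>s. is_state (Free_MV n) s \<longrightarrow> state_sat n e s \<Phi> \<longrightarrow> state_sat n e s \<Psi>)"
proof
  assume "{\<Phi>} \<turnstile>\<^sub>F\<^sub>P \<Psi>"
  from FP_sound_states[OF this, of e "event_vars \<Phi> \<union> event_vars \<Psi>" n]
  show "\<forall>s. is_state (Free_MV n) s \<longrightarrow> state_sat n e s \<Phi> \<longrightarrow> state_sat n e s \<Psi>"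
    using assms by (simp add: bij_betw_def)
next
  assume "\<forall>s. is_state (Free_MV n) s \<longrightarrow> state_sat n e s \<Phi> \<longrightarrow> state_sat n e s \<Psi>"
  then show "{\<Phi>} \<turnstile>\<^sub>F\<^sub>P \<Psi>" by (intro FP_complete[OF assms]) auto
qed

end
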